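(* Let $D\subset\mathbb C^n$ be a domain with $C^2$-smooth boundary with the following property: for every boundary point $a\in\partial D$ there are a neighborhood $U_a$ of $a$ and a plurisubharmonic function $u_a$ on $D\cap U_a$ such that $\limsup_{D\cap U_a\ni z\to a}u_a(z)=\infty$. Then $D$ is pseudoconvex.
   Context: A domain is a connected open set. $D$ is not assumed to be bounded. *)

theory Defs
  imports "HOL-Analysis.Analysis"
begin

text \<open>Functions may take the value \<open>-\<infinity>\<close>, never \<open>\<infinity>\<close>; the constant \<open>-\<infinity>\<close> is allowed.\<close>

definition usc_on :: "('a::topological_space \<Rightarrow> ereal) \<Rightarrow> 'a set \<Rightarrow> bool" where
  "usc_on u S \<longleftrightarrow>
     (\<forall>x\<in>S. u x \<noteq> \<infinity>) \<and> (\<forall>c. openin (top_of_set S) {x \<in> S. u x < c})"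

text \<open>
  The integral mean over a circle, with values in \<open>[-\<infinity>, \<infinity>)\<close>. Since \<^const>\<open>e2ennreal\<close> sends
  negative numbers to \<open>0\<close>, the two terms are the integrals of the positive and of the negative
  part. For an upper semicontinuous function the first one is finite.
\<close>

definition circle_mean :: "(complex \<Rightarrow> ereal) \<Rightarrow> complex \<Rightarrow> real \<Rightarrow> ereal" where
  "circle_mean u c r =
     (enn2ereal (\<integral>\<^sup>+\<theta>\<in>{0..2 * pi}. e2ennreal (u (c + of_real r * cis \<theta>)) \<partial>lborel)
      - enn2ereal (\<integral>\<^sup>+\<theta>\<in>{0..2 * pi}. e2ennreal (- u (c + of_real r * cis \<theta>)) \<partial>lborel))
     / ereal (2 * pi)"

definition subharmonic_on :: "(complex \<Rightarrow> ereal) \<Rightarrow> complex set \<Rightarrow> bool" where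
  "subharmonic_on u G \<longleftrightarrow>
     usc_on u G \<and> (\<forall>c r. 0 < r \<and> cball c r \<subseteq> G \<longrightarrow> u c \<le> circle_mean u c r)"

definition plurisubharmonic_on :: "(complex^'n \<Rightarrow> ereal) \<Rightarrow> (complex^'n) set \<Rightarrow> bool" where
  "plurisubharmonic_on u S \<longleftrightarrow>
     usc_on u S \<and>
     (\<forall>z w. subharmonic_on (\<lambda>\<tau>. u (z + \<tau> *s w)) {\<tau>. z + \<tau> *s w \<in> S})"

definition pseudoconvex :: "(complex^'n) set \<Rightarrow> bool" where
  "pseudoconvex D \<longleftrightarrow> open D \<and>
     (\<exists>u :: complex^'n \<Rightarrow> real.
        continuous_on D u \<and> plurisubharmonic_on (\<lambda>z. ereal (u z)) D \<and>
        (\<forall>c. compact (closure {z \<in> D. u z < c}) \<and> closure {z \<in> D. u z < c} \<subseteq> D))"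

definition C2_with_derivative_on ::
  "('a::real_normed_vector \<Rightarrow> real) \<Rightarrow> ('a \<Rightarrow> 'a \<Rightarrow>\<^sub>L real) \<Rightarrow> 'a set \<Rightarrow> bool" where
  "C2_with_derivative_on f f' U \<longleftrightarrow>
     (\<forall>x\<in>U. (f has_derivative blinfun_apply (f' x)) (at x)) \<and>
     (\<exists>f'' :: 'a \<Rightarrow> 'a \<Rightarrow>\<^sub>L ('a \<Rightarrow>\<^sub>L real).
        (\<forall>x\<in>U. (f' has_derivative blinfun_apply (f'' x)) (at x)) \<and> continuous_on U f'')"

definition C2_boundary :: "(complex^'n) set \<Rightarrow> bool" where
  "C2_boundary D \<longleftrightarrow>
     (\<forall>a \<in> frontier D. \<exists>U \<rho> \<rho>'.
        open U \<and> a \<in> U \<and> C2_with_derivative_on \<rho> \<rho>' U \<and> (\<forall>z\<in>U. \<rho>' z \<noteq> 0) \<and>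
        D \<inter> U = {z \<in> U. \<rho> z < 0})"

end

theory Submission
  imports Defs
begin

text \<open>
  Let \<open>D \<noteq> UNIV\<close>, and let \<open>\<delta> z\<close> be the distance from \<open>z\<close> to the complement of \<open>D\<close>. If \<open>- ln \<delta>\<close> satisfies the
  sub-mean inequality on every complex line, then \<open>max (- ln \<delta>) (norm z)\<^sup>2\<close> is the exhaustion
  function asked for: the first term keeps its sublevel sets away from the boundary, the second
  one keeps them bounded, also when \<open>D\<close> is not.

  Suppose that the sub-mean inequality for \<open>- ln \<delta>\<close> fails on some circle in a line in direction
  \<open>w\<close>. Compare \<open>- ln \<delta>\<close> with a harmonic polynomial that nearly agrees with it on the circle, and
  add a small multiple of \<open>\<bar>\<tau>\<bar>\<^sup>2\<close>. At an interior maximum \<open>z1\<close> of the difference, exponentiating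
  gives \<open>\<delta> (z1 + \<sigma> w) \<ge> \<delta> z1 * (\<bar>q \<sigma>\<bar> + \<epsilon> \<bar>\<sigma>\<bar>\<^sup>2)\<close> for a quadratic polynomial \<open>q\<close> with \<open>q 0 = 1\<close>. If \<open>a\<close>
  is a boundary point nearest to \<open>z1\<close>, then the disc \<open>\<sigma> \<mapsto> z1 + \<sigma> w + q \<sigma> (a - z1)\<close> passes
  through \<open>a\<close>, and its distance from the complement of \<open>D\<close> grows at least like \<open>\<bar>\<sigma>\<bar>\<^sup>2\<close>
  (\<open>touching_disc_if_not_submean\<close>).

  For a \<open>C\<^sup>2\<close> defining function \<open>\<rho>\<close> this says that \<open>\<rho>\<close> decreases quadratically along the disc, so
  that the disc is complex tangential at \<open>a\<close>. Such a strict second-order inequality is stable: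
  through every point \<open>z\<close> of \<open>D\<close> near \<open>a\<close> there is a disc of the same fixed radius on which
  \<open>\<rho>\<close> is largest at \<open>z\<close> (\<open>touching_disc_propagates\<close>). These discs lie in \<open>D\<close>, and all their boundaries
  lie in one compact subset of \<open>D\<close>. By the maximum principle, a plurisubharmonic function on \<open>D\<close>
  near \<open>a\<close> is then bounded above near \<open>a\<close>, so its upper limit at \<open>a\<close> is not \<open>\<infinity>\<close>.

  Plurisubharmonicity is a condition on complex lines, whereas the discs above are quadratic.
  The maximum principle for quadratic discs (\<open>plurisubharmonic_max_principle_quadratic_disc\<close>)
  bridges the gap without any smoothing of the plurisubharmonic function.
\<close>

section \<open>Circle means of harmonic polynomials\<close>

text \<open>
  All means that occur below are computed or estimated by comparison with real parts of complex
  polynomials, for which the mean over a circle is the value at the centre.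
\<close>

lemma circle_mean_mono:
  assumes "\<And>\<tau>. dist c \<tau> = \<bar>r\<bar> \<Longrightarrow> u \<tau> \<le> v \<tau>"
  shows "circle_mean u c r \<le> circle_mean v c r"
proof -
  have le: "u (c + of_real r * cis \<theta>) \<le> v (c + of_real r * cis \<theta>)" for \<theta>
    by (rule assms) (simp add: dist_norm norm_mult)
  have "(\<integral>\<^sup>+\<theta>\<in>{0..2 * pi}. e2ennreal (u (c + of_real r * cis \<theta>)) \<partial>lborel)
      \<le> (\<integral>\<^sup>+\<theta>\<in>{0..2 * pi}. e2ennreal (v (c + of_real r * cis \<theta>)) \<partial>lborel)"
    by (intro nn_integral_mono mult_right_mono e2ennreal_mono le) auto
  moreover have "(\<integral>\<^sup>+\<theta>\<in>{0..2 * pi}. e2ennreal (- v (c + of_real r * cis \<theta>)) \<partial>lborel)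
      \<le> (\<integral>\<^sup>+\<theta>\<in>{0..2 * pi}. e2ennreal (- u (c + of_real r * cis \<theta>)) \<partial>lborel)"
    by (intro nn_integral_mono mult_right_mono e2ennreal_mono) (auto simp: le)
  ultimately show ?thesis
    unfolding circle_mean_def
    by (intro ereal_divide_right_mono ereal_minus_mono) (auto simp: less_eq_ennreal.rep_eq)
qed

lemma has_integral_cis_multiple:
  assumes "k \<noteq> 0"
  shows "((\<lambda>\<theta>. cis (real k * \<theta>)) has_integral 0) {0..2 * pi}"
proof -
  have "((\<lambda>\<theta>. cis (real k * \<theta>)) has_integral
          (cis (real k * (2 * pi)) / (\<i> * k) - cis (real k * 0) / (\<i> * k))) {0..2 * pi}"
  proof (intro fundamental_theorem_of_calculus)
    fix x :: real
    have "((\<lambda>z. exp (\<i> * (of_nat k * z)) / (\<i> * k)) has_field_derivative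
        exp (\<i> * (of_nat k * of_real x))) (at (of_real x))"
      using assms by (auto intro!: derivative_eq_intros simp: mult.commute[of _ \<i>])
    from has_vector_derivative_real_field[OF this]
    show "((\<lambda>x. cis (real k * x) / (\<i> * k)) has_vector_derivative cis (real k * x))
        (at x within {0..2 * pi})"
      by (simp add: cis_conv_exp)
  qed simp
  moreover have "cis (real k * (2 * pi)) = 1"
    using cis_multiple_2pi[of "real k"] by (simp add: mult_ac)
  ultimately show ?thesis by simp
qed

lemma has_integral_poly_circle:
  fixes p :: "complex poly"
  shows "((\<lambda>\<theta>. poly p (of_real r * cis \<theta>)) has_integral (2 * pi * poly p 0)) {0..2 * pi}"
proof -
  have *: "((\<lambda>\<theta>. coeff p k * (of_real r * cis \<theta>) ^ k) has_integral
           (if k = 0 then 2 * pi * poly p 0 else 0)) {0..2 * pi}" for k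
  proof (cases "k = 0")
    case True
    then show ?thesis
      using has_integral_const_real[of "coeff p 0" 0 "2 * pi"]
      by (simp add: poly_0_coeff_0 scaleR_conv_of_real)
  next
    case False
    from has_integral_mult_right[OF has_integral_cis_multiple[OF False], of "coeff p k * r ^ k"]
    show ?thesis using False
      by (simp add: power_mult_distrib Complex.DeMoivre mult_ac)
  qed
  have "((\<lambda>\<theta>. \<Sum>k\<le>degree p. coeff p k * (of_real r * cis \<theta>) ^ k) has_integral
         (\<Sum>k\<le>degree p. if k = 0 then 2 * pi * poly p 0 else 0)) {0..2 * pi}"
    by (intro has_integral_sum *) auto
  then show ?thesis by (simp add: poly_altdef)
qed

lemma circle_mean_Re_poly:
  "circle_mean (\<lambda>\<tau>. ereal (Re (poly p (\<tau> - c)))) c r = ereal (Re (poly p 0))"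
proof -
  define f where "f \<theta> = Re (poly p (of_real r * cis \<theta>))" for \<theta>
  define g where "g \<theta> = indicator {0..2 * pi} \<theta> *\<^sub>R f \<theta>" for \<theta>
  have cont: "continuous_on {0..2 * pi} f"
    unfolding f_def by (intro continuous_intros)
  have int: "integrable lborel g"
    unfolding g_def
    using borel_integrable_atLeastAtMost'[OF cont] by (simp add: set_integrable_def)
  have "(f has_integral (2 * pi * Re (poly p 0))) {0..2 * pi}"
    using has_integral_linear[OF has_integral_poly_circle[of p r] bounded_linear_Re]
    by (simp add: o_def f_def[abs_def])
  then have "integral\<^sup>L lborel g = 2 * pi * Re (poly p 0)"
    using set_borel_integral_eq_integral(2)[OF borel_integrable_atLeastAtMost'[OF cont]]
    by (simp add: set_lebesgue_integral_def g_def[abs_def] integral_unique)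
  moreover have "integral\<^sup>L lborel g = enn2real (\<integral>\<^sup>+x. ennreal (g x) \<partial>lborel)
       - enn2real (\<integral>\<^sup>+x. ennreal (- g x) \<partial>lborel)"
    by (rule real_lebesgue_integral_def[OF int])
  moreover have fin: "enn2ereal X = ereal (enn2real X)" if "X \<noteq> \<infinity>" for X
    by (metis that ennreal_enn2real enn2ereal_ennreal enn2real_nonneg infinity_ennreal_def less_top)
  moreover have "enn2ereal (\<integral>\<^sup>+x. ennreal (g x) \<partial>lborel)
       = ereal (enn2real (\<integral>\<^sup>+x. ennreal (g x) \<partial>lborel))"
    "enn2ereal (\<integral>\<^sup>+x. ennreal (- g x) \<partial>lborel)
       = ereal (enn2real (\<integral>\<^sup>+x. ennreal (- g x) \<partial>lborel))"
    using int by (auto simp: real_integrable_def intro!: fin)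
  moreover have "(\<integral>\<^sup>+\<theta>\<in>{0..2 * pi}. e2ennreal (ereal (f \<theta>)) \<partial>lborel) = (\<integral>\<^sup>+x. ennreal (g x) \<partial>lborel)"
    "(\<integral>\<^sup>+\<theta>\<in>{0..2 * pi}. e2ennreal (- ereal (f \<theta>)) \<partial>lborel) = (\<integral>\<^sup>+x. ennreal (- g x) \<partial>lborel)"
    by (auto intro!: nn_integral_cong simp: g_def indicator_def e2ennreal_ereal)
  ultimately show ?thesis
    by (simp add: circle_mean_def flip: f_def)
qed

text \<open>
  On the unit circle \<open>cnj \<xi> = 1 / \<xi>\<close>, so a product of a monomial with a conjugate monomial is a
  monomial or the conjugate of one. This makes the restrictions of harmonic polynomials to the
  circle an algebra.
\<close>

lemma Re_poly_mult_cnj_on_circle: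
  fixes p q :: "complex poly"
  shows "\<exists>t. \<forall>\<xi>. cmod \<xi> = 1 \<longrightarrow> Re (poly p \<xi> * cnj (poly q \<xi>)) = Re (poly t \<xi>)"
proof (induction p q rule: poly_induct2)
  case 0
  show ?case by (intro exI[of _ 0]) simp
next
  case (pCons a p b q)
  then obtain t where t: "\<And>\<xi>. cmod \<xi> = 1 \<Longrightarrow> Re (poly p \<xi> * cnj (poly q \<xi>)) = Re (poly t \<xi>)"
    by blast
  show ?case
  proof (intro exI[of _ "smult (cnj a) (pCons b q) + smult (cnj b) (pCons 0 p) + t"] allI impI)
    fix \<xi> :: complex assume \<xi>: "cmod \<xi> = 1"
    then have "\<xi> * cnj \<xi> = 1" by (simp add: complex_norm_square[symmetric])
    then have "poly (pCons a p) \<xi> * cnj (poly (pCons b q) \<xi>) =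
        a * cnj (poly (pCons b q) \<xi>) + cnj b * (\<xi> * poly p \<xi>) + poly p \<xi> * cnj (poly q \<xi>)"
      by (simp add: algebra_simps)
    moreover have "Re (a * cnj (poly (pCons b q) \<xi>)) = Re (cnj a * poly (pCons b q) \<xi>)"
      by (simp add: algebra_simps)
    ultimately show "Re (poly (pCons a p) \<xi> * cnj (poly (pCons b q) \<xi>)) =
        Re (poly (smult (cnj a) (pCons b q) + smult (cnj b) (pCons 0 p) + t) \<xi>)"
      using t[OF \<xi>] by (simp only: plus_complex.sel poly_add poly_smult poly_pCons add_0)
  qed
qed

text \<open>
  The harmonic polynomials separate points, and they are closed under products on the circle by
  \<open>2 Re x Re y = Re (x y) + Re (x cnj y)\<close>; hence the Stone--Weierstrass theorem applies.
\<close>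

lemma Re_poly_dense_unit_circle:
  fixes g :: "complex \<Rightarrow> real"
  assumes "continuous_on (sphere 0 1) g" "e > 0"
  shows "\<exists>p. \<forall>\<xi>\<in>sphere 0 1. \<bar>g \<xi> - Re (poly p \<xi>)\<bar> < e"
proof -
  define R where "R = {f :: complex \<Rightarrow> real. \<exists>p. \<forall>\<xi>\<in>sphere 0 1. f \<xi> = Re (poly p \<xi>)}"
  interpret function_ring_on R "sphere (0::complex) 1"
  proof
    fix f h assume "f \<in> R" "h \<in> R"
    then obtain p q where pq: "\<And>\<xi>. \<xi> \<in> sphere 0 1 \<Longrightarrow> f \<xi> = Re (poly p \<xi>)"
      "\<And>\<xi>. \<xi> \<in> sphere 0 1 \<Longrightarrow> h \<xi> = Re (poly q \<xi>)"
      unfolding R_def by blast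
    show "(\<lambda>x. f x + h x) \<in> R"
      unfolding R_def using pq by (auto intro!: exI[of _ "p + q"])
    obtain t where t: "\<And>\<xi>. cmod \<xi> = 1 \<Longrightarrow> Re (poly p \<xi> * cnj (poly q \<xi>)) = Re (poly t \<xi>)"
      using Re_poly_mult_cnj_on_circle by blast
    have "f \<xi> * h \<xi> = Re (poly (smult (1/2) (p * q + t)) \<xi>)" if "\<xi> \<in> sphere 0 1" for \<xi>
    proof -
      have "Re (poly t \<xi>) = Re (poly p \<xi>) * Re (poly q \<xi>) + Im (poly p \<xi>) * Im (poly q \<xi>)"
        using t[of \<xi>] that by simp
      then show ?thesis using pq[OF that] by simp
    qed
    then show "(\<lambda>x. f x * h x) \<in> R"
      unfolding R_def by blast
  next
    fix f assume "f \<in> R"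
    then obtain p where "\<And>\<xi>. \<xi> \<in> sphere 0 1 \<Longrightarrow> f \<xi> = Re (poly p \<xi>)"
      unfolding R_def by blast
    then show "continuous_on (sphere 0 1) f"
      by (subst continuous_on_cong[OF refl, of _ _ "\<lambda>\<xi>. Re (poly p \<xi>)"])
         (auto intro!: continuous_intros)
  next
    fix c show "(\<lambda>_. c) \<in> R"
      unfolding R_def by (auto intro!: exI[of _ "[:of_real c:]"])
  next
    fix x y :: complex assume "x \<noteq> y"
    have "(\<lambda>\<xi>. Re (poly [:0, 1:] \<xi>)) \<in> R" "(\<lambda>\<xi>. Re (poly [:0, -\<i>:] \<xi>)) \<in> R"
      unfolding R_def by blast+
    then have "Re \<in> R" "Im \<in> R"
      by simp_all
    moreover have "Re x \<noteq> Re y \<or> Im x \<noteq> Im y"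
      using \<open>x \<noteq> y\<close> by (auto simp: complex_eq_iff)
    ultimately show "\<exists>f\<in>R. f x \<noteq> f y"
      by blast
  qed auto
  obtain f where "f \<in> R" "\<And>x. x \<in> sphere 0 1 \<Longrightarrow> \<bar>g x - f x\<bar> < e"
    using Stone_Weierstrass_basic[OF assms] by (auto simp: abs_minus_commute)
  then show ?thesis unfolding R_def by force
qed

lemma Re_poly_dense_circle:
  fixes g :: "complex \<Rightarrow> real"
  assumes "continuous_on (sphere c r) g" "r > 0" "e > 0"
  obtains p where "\<And>\<tau>. \<tau> \<in> sphere c r \<Longrightarrow> \<bar>g \<tau> - Re (poly p (\<tau> - c))\<bar> < e"
proof -
  have "continuous_on (sphere 0 1) (\<lambda>\<xi>. g (c + of_real r * \<xi>))"
    using \<open>r > 0\<close>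
    by (intro continuous_on_compose2[OF assms(1)]) (auto intro!: continuous_intros simp: dist_norm norm_mult)
  from Re_poly_dense_unit_circle[OF this \<open>e > 0\<close>]
  obtain p where p: "\<And>\<xi>. \<xi> \<in> sphere 0 1 \<Longrightarrow> \<bar>g (c + of_real r * \<xi>) - Re (poly p \<xi>)\<bar> < e"
    by blast
  show ?thesis
  proof
    fix \<tau> assume "\<tau> \<in> sphere c r"
    then have "(\<tau> - c) / r \<in> sphere 0 1"
      using \<open>r > 0\<close> by (auto simp: norm_divide dist_norm norm_minus_commute)
    from p[OF this] \<open>r > 0\<close>
    show "\<bar>g \<tau> - Re (poly (p \<circ>\<^sub>p [:0, 1 / of_real r:]) (\<tau> - c))\<bar> < e"
      by (simp add: poly_pcompose)
  qed
qed

section \<open>Complex scalar multiples of vectors\<close>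

lemma norm_vector_smult: "norm (c *s (x :: complex^'n)) = cmod c * norm x"
  by (simp add: norm_vec_def norm_mult L2_set_right_distrib)

lemma continuous_on_vector_smult [continuous_intros]:
  fixes f :: "'a::topological_space \<Rightarrow> complex" and g :: "'a \<Rightarrow> complex^'n"
  assumes "continuous_on S f" "continuous_on S g"
  shows "continuous_on S (\<lambda>x. f x *s g x)"
  using assms unfolding vector_scalar_mult_def
  by (intro continuous_on_vec_lambda continuous_intros)

lemma inner_smult_eq_Re: "inner h (\<tau> *s (B :: complex^'n)) = Re ((\<Sum>i\<in>UNIV. cnj (h $ i) * B $ i) * \<tau>)"
proof -
  have "inner h (\<tau> *s B) = (\<Sum>i\<in>UNIV. Re (cnj (h $ i) * B $ i * \<tau>))"
    unfolding inner_vec_def by (intro sum.cong) (auto simp: inner_complex_def algebra_simps)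
  then show ?thesis by (simp only: Re_sum sum_distrib_right)
qed

section \<open>Upper semicontinuous functions\<close>

lemma usc_attains_sup:
  fixes F :: "'a::topological_space \<Rightarrow> ereal"
  assumes "compact S" "S \<noteq> {}"
    and usc: "\<And>x c. x \<in> S \<Longrightarrow> F x < c \<Longrightarrow> eventually (\<lambda>y. F y < c) (at x within S)"
  obtains x where "x \<in> S" "\<And>y. y \<in> S \<Longrightarrow> F y \<le> F x"
proof (rule ccontr)
  assume "\<not> thesis"
  then have "\<forall>x\<in>S. \<exists>y\<in>S. F x < F y"
    using that by (meson not_le)
  then obtain g where g: "\<And>x. x \<in> S \<Longrightarrow> g x \<in> S" "\<And>x. x \<in> S \<Longrightarrow> F x < F (g x)"
    by metis
  have "\<forall>x\<in>S. \<exists>T. open T \<and> x \<in> T \<and> (\<forall>y\<in>T \<inter> S. F y < F (g x))"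
  proof
    fix x assume "x \<in> S"
    from usc[OF this g(2)[OF this]] g(2)[OF this]
    show "\<exists>T. open T \<and> x \<in> T \<and> (\<forall>y\<in>T \<inter> S. F y < F (g x))"
      unfolding eventually_at_topological by auto
  qed
  then obtain T where "\<forall>x\<in>S. open (T x) \<and> x \<in> T x \<and> (\<forall>y\<in>T x \<inter> S. F y < F (g x))"
    by (rule bchoice[THEN exE])
  then have T: "\<And>x. x \<in> S \<Longrightarrow> open (T x)" "\<And>x. x \<in> S \<Longrightarrow> x \<in> T x"
    "\<And>x y. x \<in> S \<Longrightarrow> y \<in> T x \<Longrightarrow> y \<in> S \<Longrightarrow> F y < F (g x)"
    by auto
  obtain C where C: "C \<subseteq> S" "finite C" "S \<subseteq> (\<Union>x\<in>C. T x)"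
  proof (rule compactE_image[OF \<open>compact S\<close> T(1)])
    show "S \<subseteq> (\<Union>x\<in>S. T x)" using T(2) by auto
  qed
  then have "C \<noteq> {}" using \<open>S \<noteq> {}\<close> by auto
  define m where "m = Max ((F \<circ> g) ` C)"
  have "m \<in> (F \<circ> g) ` C"
    unfolding m_def using C \<open>C \<noteq> {}\<close> by (intro Max_in) auto
  then obtain x where x: "x \<in> C" "m = F (g x)" by auto
  then have "g x \<in> S" using g C by auto
  then obtain y where y: "y \<in> C" "g x \<in> T y" using C by blast
  then have "m < F (g y)" using T(3)[of y "g x"] x C \<open>g x \<in> S\<close> by auto
  moreover have "F (g y) \<le> m" unfolding m_def using C y by (intro Max_ge) auto
  ultimately show False by simp
qed

lemma usc_add_continuous:
  fixes f :: "'a::t2_space \<Rightarrow> ereal" and g :: "'a \<Rightarrow> real"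
  assumes f: "\<And>c. f x < c \<Longrightarrow> eventually (\<lambda>y. f y < c) (at x within S)"
    and g: "continuous_on S g" and "x \<in> S" and c: "f x + ereal (g x) < c"
  shows "eventually (\<lambda>y. f y + ereal (g y) < c) (at x within S)"
proof -
  have "f x < c - ereal (g x)"
    using c by (cases "f x"; cases c) auto
  then obtain d where d: "f x < ereal d" "ereal d < c - ereal (g x)"
    using ereal_dense2 by blast
  have "ereal (g x) < c - ereal d"
    using d(2) by (cases c) auto
  then obtain e where e: "ereal (g x) < ereal e" "ereal e < c - ereal d"
    using ereal_dense2 by blast
  have de: "ereal d + ereal e < c" using e(2) by (cases c) auto
  have "eventually (\<lambda>y. g y < e) (at x within S)"
    using g \<open>x \<in> S\<close> e(1) by (auto simp: continuous_on_def intro: order_tendstoD)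
  with f[OF d(1)] show ?thesis
  proof eventually_elim
    case (elim y)
    then have "f y + ereal (g y) < ereal d + ereal e"
      by (cases "f y") auto
    with de show ?case by simp
  qed
qed

lemma usc_compose:
  assumes u: "usc_on u G" and k: "continuous_on S k" "k ` S \<subseteq> G" and "x \<in> S" "u (k x) < c"
  shows "eventually (\<lambda>y. u (k y) < c) (at x within S)"
proof -
  have "openin (top_of_set G) {x \<in> G. u x < c}"
    using u by (simp add: usc_on_def)
  then obtain T where T: "open T" "{x \<in> G. u x < c} = G \<inter> T"
    by (auto simp: openin_open)
  then have "k x \<in> T" using assms by auto
  then have "eventually (\<lambda>y. k y \<in> T) (at x within S)"
    using k(1) \<open>x \<in> S\<close> T(1) by (auto simp: continuous_on_def intro: topological_tendstoD)
  moreover have "eventually (\<lambda>y. y \<in> S) (at x within S)"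
    by (simp add: eventually_at_filter)
  ultimately show ?thesis
    by eventually_elim (use T k in blast)
qed

lemma usc_bounded_above_on_compact:
  assumes u: "usc_on u G" and "compact K" "K \<subseteq> G"
  obtains M :: real where "\<And>x. x \<in> K \<Longrightarrow> u x \<le> ereal M"
proof (cases "K = {}")
  case False
  obtain x where x: "x \<in> K" "\<And>y. y \<in> K \<Longrightarrow> u y \<le> u x"
  proof (rule usc_attains_sup[OF \<open>compact K\<close> False, of u])
    fix x c assume "x \<in> K" "u x < c"
    then show "eventually (\<lambda>y. u y < c) (at x within K)"
      using usc_compose[OF u, of K "\<lambda>x. x"] assms by auto
  qed auto
  have "u x \<noteq> \<infinity>" using u x assms by (auto simp: usc_on_def)
  then have "u x \<le> ereal (real_of_ereal (u x))" by (cases "u x") auto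
  then show ?thesis using x that by (meson order_trans)
qed (use that in auto)

section \<open>The maximum principle on quadratic discs\<close>

lemma plurisubharmonic_le_Re_poly:
  fixes u :: "complex^'n \<Rightarrow> ereal"
  assumes u: "plurisubharmonic_on u G" and "s > 0"
    and sub: "\<And>\<tau>. cmod \<tau> \<le> s \<Longrightarrow> z + \<tau> *s w \<in> G"
    and le: "\<And>\<tau>. cmod \<tau> = s \<Longrightarrow> u (z + \<tau> *s w) \<le> ereal (Re (poly p \<tau>))"
  shows "u z \<le> ereal (Re (poly p 0))"
proof -
  have "subharmonic_on (\<lambda>\<tau>. u (z + \<tau> *s w)) {\<tau>. z + \<tau> *s w \<in> G}"
    using u by (simp add: plurisubharmonic_on_def)
  moreover have "cball 0 s \<subseteq> {\<tau>. z + \<tau> *s w \<in> G}"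
    using sub by auto
  ultimately have "u (z + 0 *s w) \<le> circle_mean (\<lambda>\<tau>. u (z + \<tau> *s w)) 0 s"
    using \<open>s > 0\<close> unfolding subharmonic_on_def by blast
  also have "\<dots> \<le> circle_mean (\<lambda>\<tau>. ereal (Re (poly p (\<tau> - 0)))) 0 s"
    using \<open>s > 0\<close> by (intro circle_mean_mono) (auto intro: le)
  also have "\<dots> = ereal (Re (poly p 0))"
    by (rule circle_mean_Re_poly)
  finally show ?thesis by simp
qed

text \<open>
  Thicken the disc to a tube with points \<open>\<phi> \<tau> + h\<close>, and maximize
  \<open>u (\<phi> \<tau> + h) + \<eta> \<bar>\<tau>\<bar>\<^sup>2 - K \<bar>h\<bar>\<^sup>2\<close> over the tube, with \<open>\<eta>\<close> small and \<open>K\<close> large. If \<open>u z > M\<close>, the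
  maximum is attained at an interior point \<open>(\<tau>0, h0)\<close>. The complex line through
  \<open>\<phi> \<tau>0 + h0\<close> in the tangential direction \<open>\<phi>' \<tau>0\<close> consists of the tube points with parameters
  \<open>(\<tau>0 + \<sigma>, h0 - \<sigma>\<^sup>2 B)\<close>. Along it, the penalty \<open>K \<bar>h\<bar>\<^sup>2\<close> differs from a harmonic function only by
  a term of order \<open>\<bar>\<sigma>\<bar>\<^sup>4\<close>, which cannot compensate \<open>\<eta> \<bar>\<sigma>\<bar>\<^sup>2\<close>. So the mean of \<open>u\<close> over a small circle
  is less than the value at its centre, against plurisubharmonicity on lines.
\<close>

lemma plurisubharmonic_max_principle_quadratic_disc:
  fixes u :: "complex^'n \<Rightarrow> ereal" and z A B :: "complex^'n"
  defines "\<phi> \<equiv> \<lambda>\<tau>. z + \<tau> *s A + \<tau>\<^sup>2 *s B"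
  assumes u: "plurisubharmonic_on u G" and "open G" "r > 0"
    and disc: "\<And>\<tau>. cmod \<tau> \<le> r \<Longrightarrow> \<phi> \<tau> \<in> G"
    and "open W" and bdry: "\<And>\<tau>. cmod \<tau> = r \<Longrightarrow> \<phi> \<tau> \<in> W"
    and le: "\<And>x. x \<in> G \<inter> W \<Longrightarrow> u x \<le> ereal M"
  shows "u z \<le> ereal M"
proof (rule ccontr)
  assume "\<not> u z \<le> ereal M"
  then have gt: "ereal M < u z" by simp
  have usc: "usc_on u G" using u by (simp add: plurisubharmonic_on_def)
  have \<phi>0: "\<phi> 0 = z" by (simp add: \<phi>_def)
  then have "z \<in> G" using disc[of 0] \<open>r > 0\<close> by simp
  then have "u z \<noteq> \<infinity>" using usc by (auto simp: usc_on_def)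
  with gt obtain m where m: "u z = ereal m" "M < m" by (cases "u z") auto
  have cont: "continuous_on S \<phi>" for S unfolding \<phi>_def by (intro continuous_intros)
  have disc': "\<phi> ` cball 0 r \<subseteq> G" and bdry': "\<phi> ` sphere 0 r \<subseteq> W"
    using disc bdry by auto
  have "compact (\<phi> ` cball 0 r)" by (intro compact_continuous_image cont) auto
  then obtain e1 where e1: "e1 > 0" "(\<Union>x\<in>\<phi> ` cball 0 r. cball x e1) \<subseteq> G"
    using compact_subset_open_imp_cball_epsilon_subset[OF _ \<open>open G\<close>] disc' by blast
  have "compact (\<phi> ` sphere 0 r)" by (intro compact_continuous_image cont) auto
  then obtain e2 where e2: "e2 > 0" "(\<Union>x\<in>\<phi> ` sphere 0 r. cball x e2) \<subseteq> W"
    using compact_subset_open_imp_cball_epsilon_subset[OF _ \<open>open W\<close>] bdry' by blast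
  define e where "e = min e1 e2"
  have "e > 0" using e1 e2 by (simp add: e_def)
  have tube: "\<phi> \<tau> + h \<in> G" if "cmod \<tau> \<le> r" "norm h \<le> e" for \<tau> h
  proof -
    have "\<phi> \<tau> + h \<in> cball (\<phi> \<tau>) e1" using that by (simp add: dist_norm e_def)
    then show ?thesis using that e1 by fastforce
  qed
  have tube2: "u (\<phi> \<tau> + h) \<le> ereal M" if "cmod \<tau> = r" "norm h \<le> e" for \<tau> h
  proof -
    have "\<phi> \<tau> + h \<in> cball (\<phi> \<tau>) e2" using that by (simp add: dist_norm e_def)
    then have "\<phi> \<tau> + h \<in> W" using that e2 by fastforce
    then show ?thesis using le tube[of \<tau> h] that by simp
  qed
  define S where "S = cball (0::complex) r \<times> cball (0 :: complex^'n) e"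
  have "compact S" unfolding S_def by (intro compact_Times) auto
  have "(0, 0) \<in> S" using \<open>r > 0\<close> \<open>e > 0\<close> by (simp add: S_def)
  define k where "k = (\<lambda>x. \<phi> (fst x) + snd x)"
  have contk: "continuous_on S k"
    unfolding k_def \<phi>_def by (intro continuous_intros)
  have kS: "k ` S \<subseteq> G" using tube by (auto simp: k_def S_def)
  obtain M' where M': "\<And>x. x \<in> k ` S \<Longrightarrow> u x \<le> ereal M'"
    using usc_bounded_above_on_compact[OF usc compact_continuous_image[OF contk \<open>compact S\<close>] kS] by blast
  \<comment> \<open>so small that the maximum is not attained over \<open>\<bar>\<tau>\<bar> = r\<close>\<close>
  define \<eta> where "\<eta> = (m - M) / (2 * r\<^sup>2)"
  have "\<eta> > 0" using m \<open>r > 0\<close> by (simp add: \<eta>_def)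
  have \<eta>: "M + \<eta> * r\<^sup>2 < m" using m \<open>r > 0\<close> by (simp add: \<eta>_def field_simps)
  \<comment> \<open>so large that the maximum is not attained over \<open>norm h = e\<close>\<close>
  define K where "K = (\<bar>M' + \<eta> * r\<^sup>2 - m\<bar> + 1) / e\<^sup>2"
  have "K > 0" using \<open>e > 0\<close> by (simp add: K_def)
  have K: "M' + \<eta> * r\<^sup>2 - K * e\<^sup>2 < m" using \<open>e > 0\<close> by (simp add: K_def)
  define \<psi> :: "complex \<times> (complex^'n) \<Rightarrow> real"
    where "\<psi> x = \<eta> * (cmod (fst x))\<^sup>2 - K * (norm (snd x))\<^sup>2" for x
  have cont\<psi>: "continuous_on S \<psi>" unfolding \<psi>_def by (intro continuous_intros)
  obtain x0 where x0: "x0 \<in> S"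
    and max: "\<And>x. x \<in> S \<Longrightarrow> u (k x) + ereal (\<psi> x) \<le> u (k x0) + ereal (\<psi> x0)"
  proof (rule usc_attains_sup[OF \<open>compact S\<close>, of "\<lambda>x. u (k x) + ereal (\<psi> x)"])
    show "S \<noteq> {}" using \<open>(0, 0) \<in> S\<close> by auto
    fix x c assume "x \<in> S" "u (k x) + ereal (\<psi> x) < c"
    then show "eventually (\<lambda>x. u (k x) + ereal (\<psi> x) < c) (at x within S)"
      using usc_compose[OF usc contk kS] by (intro usc_add_continuous cont\<psi>) auto
  qed auto
  obtain \<tau>0 h0 where x0_eq: "x0 = (\<tau>0, h0)" by (cases x0)
  have in_S: "cmod \<tau>0 \<le> r" "norm h0 \<le> e" using x0 by (auto simp: S_def x0_eq)
  have ge_m: "ereal m \<le> u (k x0) + ereal (\<psi> x0)"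
    using max[OF \<open>(0, 0) \<in> S\<close>] by (simp add: k_def \<psi>_def \<phi>0 m)
  have "u (k x0) \<le> ereal M'" using M' x0 by auto
  then obtain v where v: "u (k x0) = ereal v" "v \<le> M'"
    using ge_m by (cases "u (k x0)") auto
  have v_ge: "m \<le> v + \<psi> x0" using ge_m v by simp
  have \<tau>0_lt: "cmod \<tau>0 < r"
  proof (rule ccontr)
    assume "\<not> cmod \<tau>0 < r"
    then have eq: "cmod \<tau>0 = r" using in_S by simp
    then have "v \<le> M" using tube2[OF eq in_S(2)] v by (simp add: k_def x0_eq)
    moreover have "\<psi> x0 \<le> \<eta> * r\<^sup>2" using \<open>K > 0\<close> by (simp add: \<psi>_def x0_eq eq)
    ultimately show False using v_ge \<eta> by simp
  qed
  have h0_lt: "norm h0 < e"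
  proof (rule ccontr)
    assume "\<not> norm h0 < e"
    then have eq: "norm h0 = e" using in_S by simp
    have "(cmod \<tau>0)\<^sup>2 \<le> r\<^sup>2" using in_S by (intro power_mono) auto
    then have "\<psi> x0 \<le> \<eta> * r\<^sup>2 - K * e\<^sup>2" using \<open>\<eta> > 0\<close> by (simp add: \<psi>_def x0_eq eq)
    then show False using v_ge K v by simp
  qed
  define p where "p = k x0"
  define A' where "A' = A + (2 * \<tau>0) *s B"
  have line: "p + \<sigma> *s A' = k (\<tau>0 + \<sigma>, h0 - \<sigma>\<^sup>2 *s B)" for \<sigma>
    by (vector p_def k_def x0_eq \<phi>_def A'_def power2_eq_square) (simp add: algebra_simps)
  \<comment> \<open>a radius for which the circle stays in the tube and \<open>\<eta> s\<^sup>2\<close> outweighs the quartic term\<close>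
  have "\<forall>\<^sub>F s in at_right 0. (s::real) < r - cmod \<tau>0"
    using \<tau>0_lt by (intro order_tendstoD(2)[OF tendsto_ident_at]) auto
  moreover have "\<forall>\<^sub>F s in at_right 0. s\<^sup>2 * norm B < e - norm h0"
    using h0_lt by (intro order_tendstoD(2)[of _ "0\<^sup>2 * norm B"] tendsto_intros) auto
  moreover have "\<forall>\<^sub>F s in at_right 0. s\<^sup>2 * (K * (norm B)\<^sup>2) < \<eta>"
    using \<open>\<eta> > 0\<close> by (intro order_tendstoD(2)[of _ "0\<^sup>2 * (K * (norm B)\<^sup>2)"] tendsto_intros) auto
  moreover have "\<forall>\<^sub>F s in at_right 0. (s::real) > 0"
    by (simp add: eventually_at_right_less)
  ultimately have "\<forall>\<^sub>F s in at_right 0. (s::real) > 0 \<and> s < r - cmod \<tau>0 \<and> s\<^sup>2 * norm B < e - norm h0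
      \<and> s\<^sup>2 * (K * (norm B)\<^sup>2) < \<eta>"
    by eventually_elim auto
  then obtain s where s: "s > 0" "s < r - cmod \<tau>0" "s\<^sup>2 * norm B < e - norm h0"
      "s\<^sup>2 * (K * (norm B)\<^sup>2) < \<eta>"
    using eventually_happens'[OF trivial_limit_at_right_real] by blast
  have near: "(\<tau>0 + \<sigma>, h0 - \<sigma>\<^sup>2 *s B) \<in> S" if "cmod \<sigma> \<le> s" for \<sigma>
  proof -
    have "cmod (\<tau>0 + \<sigma>) \<le> r" using norm_triangle_ineq[of \<tau>0 \<sigma>] s that by simp
    moreover have "(cmod \<sigma>)\<^sup>2 * norm B \<le> s\<^sup>2 * norm B"
      using that by (intro mult_right_mono power_mono) auto
    then have "norm (h0 - \<sigma>\<^sup>2 *s B) \<le> e"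
      using norm_triangle_ineq4[of h0 "\<sigma>\<^sup>2 *s B"] s by (simp add: norm_vector_smult norm_power)
    ultimately show ?thesis by (simp add: S_def)
  qed
  define \<kappa> where "\<kappa> = (\<Sum>i\<in>UNIV. cnj (h0 $ i) * B $ i)"
  \<comment> \<open>the mean over the circle \<open>\<bar>\<sigma>\<bar> = s\<close> of the bound on \<open>u\<close> that maximality at \<open>x0\<close> gives\<close>
  define C where "C = v - (\<eta> - s\<^sup>2 * (K * (norm B)\<^sup>2)) * s\<^sup>2"
  have "u p \<le> ereal (Re (poly [: of_real C, - (2 * \<eta> * cnj \<tau>0), - (2 * K * \<kappa>) :] 0))"
  proof (rule plurisubharmonic_le_Re_poly[OF u \<open>s > 0\<close>, of p A'])
    fix \<sigma> assume "cmod \<sigma> \<le> s"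
    then show "p + \<sigma> *s A' \<in> G" using near kS by (auto simp: line)
  next
    fix \<sigma> assume \<sigma>: "cmod \<sigma> = s"
    define x where "x = (\<tau>0 + \<sigma>, h0 - \<sigma>\<^sup>2 *s B)"
    have "u (k x) + ereal (\<psi> x) \<le> ereal (v + \<psi> x0)"
      using max[of x] near[of \<sigma>] \<sigma> v by (simp add: x_def)
    then have "u (k x) \<le> ereal (v + \<psi> x0 - \<psi> x)"
      by (cases "u (k x)") auto
    moreover have "(norm (h0 - \<sigma>\<^sup>2 *s B))\<^sup>2 = (norm h0)\<^sup>2 - 2 * Re (\<kappa> * \<sigma>\<^sup>2) + s\<^sup>2 * s\<^sup>2 * (norm B)\<^sup>2"
    proof -
      have "(norm (h0 - \<sigma>\<^sup>2 *s B))\<^sup>2 = (norm h0)\<^sup>2 - 2 * inner h0 (\<sigma>\<^sup>2 *s B) + (norm (\<sigma>\<^sup>2 *s B))\<^sup>2"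
        by (simp add: power2_norm_eq_inner algebra_simps inner_commute)
      then show ?thesis
        by (simp add: inner_smult_eq_Re \<kappa>_def norm_vector_smult norm_power \<sigma> power_mult_distrib
                      power2_eq_square[of "s\<^sup>2"])
    qed
    moreover have "(cmod (\<tau>0 + \<sigma>))\<^sup>2 = (cmod \<tau>0)\<^sup>2 + 2 * Re (cnj \<tau>0 * \<sigma>) + s\<^sup>2"
      unfolding \<sigma>[symmetric] cmod_power2 by (simp add: power2_eq_square algebra_simps)
    ultimately have "u (k x) \<le> ereal (v + (\<eta> * (cmod \<tau>0)\<^sup>2 - K * (norm h0)\<^sup>2)
        - (\<eta> * ((cmod \<tau>0)\<^sup>2 + 2 * Re (cnj \<tau>0 * \<sigma>) + s\<^sup>2)
        - K * ((norm h0)\<^sup>2 - 2 * Re (\<kappa> * \<sigma>\<^sup>2) + s\<^sup>2 * s\<^sup>2 * (norm B)\<^sup>2)))"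
      by (simp only: \<psi>_def x_def x0_eq fst_conv snd_conv)
    also have "\<dots> = ereal (C - 2 * \<eta> * Re (cnj \<tau>0 * \<sigma>) - 2 * K * Re (\<kappa> * \<sigma>\<^sup>2))"
      by (simp add: C_def algebra_simps)
    also have "\<dots> = ereal (Re (poly [: of_real C, - (2 * \<eta> * cnj \<tau>0), - (2 * K * \<kappa>) :] \<sigma>))"
      by (simp add: algebra_simps power2_eq_square)
    finally show "u (p + \<sigma> *s A') \<le> ereal (Re (poly [: of_real C, - (2 * \<eta> * cnj \<tau>0), - (2 * K * \<kappa>) :] \<sigma>))"
      by (simp add: line x_def)
  qed
  then have "v \<le> C" by (simp add: p_def v)
  moreover have "(\<eta> - s\<^sup>2 * (K * (norm B)\<^sup>2)) * s\<^sup>2 > 0" using s by simp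
  ultimately show False by (simp add: C_def)
qed

section \<open>Discs touching the boundary\<close>

text \<open>
  Subtract from \<open>v\<close> a harmonic polynomial that nearly agrees with \<open>v\<close> on the circle and add
  \<open>\<epsilon> \<bar>\<tau> - c\<bar>\<^sup>2\<close> with \<open>\<epsilon>\<close> small: the difference is still larger at the centre than on the circle, so it has an
  interior maximum \<open>\<tau>1\<close>. Recentring the square at \<open>\<tau>1\<close> changes it only by a harmonic polynomial.
\<close>

lemma touching_polynomial_if_not_submean:
  fixes v :: "complex \<Rightarrow> real"
  assumes v: "continuous_on (cball c r) v" and "r > 0"
    and fail: "\<not> ereal (v c) \<le> circle_mean (\<lambda>\<tau>. ereal (v \<tau>)) c r"
  obtains \<tau>1 p \<epsilon> where "\<tau>1 \<in> ball c r" "\<epsilon> > 0" "poly p 0 = 0"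
    "\<And>\<tau>. \<tau> \<in> cball c r \<Longrightarrow> v \<tau> \<le> v \<tau>1 + Re (poly p (\<tau> - \<tau>1)) - \<epsilon> * (cmod (\<tau> - \<tau>1))\<^sup>2"
proof -
  obtain m where m: "circle_mean (\<lambda>\<tau>. ereal (v \<tau>)) c r < ereal m" "m < v c"
    using fail ereal_dense2[of "circle_mean (\<lambda>\<tau>. ereal (v \<tau>)) c r" "ereal (v c)"]
    by (auto simp: not_le)
  define \<eta> where "\<eta> = (v c - m) / 3"
  have "\<eta> > 0" using m by (simp add: \<eta>_def)
  obtain p0 where p0: "\<And>\<tau>. \<tau> \<in> sphere c r \<Longrightarrow> \<bar>v \<tau> - Re (poly p0 (\<tau> - c))\<bar> < \<eta>"
    using Re_poly_dense_circle[OF continuous_on_subset[OF v sphere_cball] \<open>r > 0\<close> \<open>\<eta> > 0\<close>] by blast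
  have "ereal (Re (poly (p0 - [:of_real \<eta>:]) 0))
      = circle_mean (\<lambda>\<tau>. ereal (Re (poly (p0 - [:of_real \<eta>:]) (\<tau> - c)))) c r"
    by (rule circle_mean_Re_poly[symmetric])
  also have "\<dots> \<le> circle_mean (\<lambda>\<tau>. ereal (v \<tau>)) c r"
  proof (rule circle_mean_mono)
    fix \<tau> assume "dist c \<tau> = \<bar>r\<bar>"
    then show "ereal (Re (poly (p0 - [:of_real \<eta>:]) (\<tau> - c))) \<le> ereal (v \<tau>)"
      using p0[of \<tau>] \<open>r > 0\<close> by simp
  qed
  also note m(1)
  finally have p00: "Re (poly p0 0) - \<eta> < m" by simp
  define \<epsilon> where "\<epsilon> = \<eta> / r\<^sup>2"
  have "\<epsilon> > 0" using \<open>\<eta> > 0\<close> \<open>r > 0\<close> by (simp add: \<epsilon>_def)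
  define g where "g \<tau> = v \<tau> - Re (poly p0 (\<tau> - c)) + \<epsilon> * (cmod (\<tau> - c))\<^sup>2" for \<tau>
  have "continuous_on (cball c r) g"
    unfolding g_def by (intro continuous_intros v)
  then obtain \<tau>1 where \<tau>1: "\<tau>1 \<in> cball c r" "\<And>\<tau>. \<tau> \<in> cball c r \<Longrightarrow> g \<tau> \<le> g \<tau>1"
    using continuous_attains_sup[of "cball c r" g] \<open>r > 0\<close> by auto
  have "g c > 2 * \<eta>" using p00 by (simp add: g_def \<eta>_def field_simps)
  moreover have "g \<tau> < 2 * \<eta>" if "\<tau> \<in> sphere c r" for \<tau>
    using p0[OF that] that \<open>r > 0\<close> by (simp add: g_def \<epsilon>_def dist_norm norm_minus_commute)
  ultimately have "\<tau>1 \<notin> sphere c r" using \<tau>1(2)[of c] \<open>r > 0\<close> by force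
  with \<tau>1(1) have ball: "\<tau>1 \<in> ball c r" by auto
  define p where "p = p0 \<circ>\<^sub>p [:\<tau>1 - c, 1:] - [:poly p0 (\<tau>1 - c), 2 * \<epsilon> * cnj (\<tau>1 - c):]"
  show thesis
  proof (rule that[OF ball \<open>\<epsilon> > 0\<close>])
    show "poly p 0 = 0" by (simp add: p_def poly_pcompose)
    fix \<tau> assume "\<tau> \<in> cball c r"
    then have "g \<tau> \<le> g \<tau>1" by (rule \<tau>1(2))
    moreover have "(cmod (\<tau> - c))\<^sup>2 = (cmod (\<tau>1 - c))\<^sup>2 + 2 * Re (cnj (\<tau>1 - c) * (\<tau> - \<tau>1))
        + (cmod (\<tau> - \<tau>1))\<^sup>2"
      unfolding cmod_power2 by (simp add: power2_eq_square algebra_simps)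
    moreover have "Re (poly p (\<tau> - \<tau>1)) = Re (poly p0 (\<tau> - c)) - Re (poly p0 (\<tau>1 - c))
        - \<epsilon> * (2 * Re (cnj (\<tau>1 - c) * (\<tau> - \<tau>1)))"
      by (simp add: p_def poly_pcompose algebra_simps)
    ultimately show "v \<tau> \<le> v \<tau>1 + Re (poly p (\<tau> - \<tau>1)) - \<epsilon> * (cmod (\<tau> - \<tau>1))\<^sup>2"
      by (simp only: g_def distrib_left)
  qed
qed

text \<open>
  The derivatives of \<open>exp (- p)\<close> have the form \<open>f exp (- p)\<close> with \<open>f\<close> a polynomial, and
  \<open>f \<mapsto> f' - p' f\<close> passes from one to the next. Bounding the third one gives the remainder of the
  Taylor polynomial of degree two.
\<close>

lemma exp_poly_quadratic_approx:
  fixes p :: "complex poly"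
  assumes "poly p 0 = 0"
  obtains b d C where "\<And>\<sigma>. cmod \<sigma> \<le> 1 \<Longrightarrow> cmod (exp (- poly p \<sigma>) - (1 + b * \<sigma> + d * \<sigma>\<^sup>2)) \<le> C * cmod \<sigma> ^ 3"
proof -
  define E where "E \<sigma> = exp (- poly p \<sigma>)" for \<sigma>
  have E: "((\<lambda>\<sigma>. poly f \<sigma> * E \<sigma>) has_field_derivative poly (pderiv f - pderiv p * f) x * E x) (at x within S)"
    for f x S
    unfolding E_def
    by (auto intro!: derivative_eq_intros simp: algebra_simps)
  define f where "f i = ((\<lambda>f. pderiv f - pderiv p * f) ^^ i) [:1:]" for i
  have f0: "f 0 = [:1:]" by (simp add: f_def)
  have fS: "f (Suc i) = pderiv (f i) - pderiv p * f i" for i by (simp add: f_def)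
  have "compact ((\<lambda>\<sigma>. poly (f 3) \<sigma> * E \<sigma>) ` cball 0 1)"
    unfolding E_def by (intro compact_continuous_image continuous_intros) auto
  then obtain C where C: "\<And>\<sigma>. \<sigma> \<in> cball 0 1 \<Longrightarrow> cmod (poly (f 3) \<sigma> * E \<sigma>) \<le> C"
    using compact_imp_bounded bounded_iff by (metis (no_types, lifting) imageI)
  show ?thesis
  proof (rule that)
    fix \<sigma> :: complex assume \<sigma>: "cmod \<sigma> \<le> 1"
    have "cmod (poly (f 0) \<sigma> * E \<sigma> - (\<Sum>i\<le>2. poly (f i) 0 * E 0 * (\<sigma> - 0) ^ i / fact i))
        \<le> C * cmod (\<sigma> - 0) ^ Suc 2 / fact 2"
    proof (rule complex_Taylor[where S = "cball 0 1" and f = "\<lambda>i \<sigma>. poly (f i) \<sigma> * E \<sigma>"])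
      show "((\<lambda>\<sigma>. poly (f i) \<sigma> * E \<sigma>) has_field_derivative poly (f (Suc i)) x * E x) (at x within cball 0 1)"
        for i x
        unfolding fS by (rule E)
      show "cmod (poly (f (Suc 2)) x * E x) \<le> C" if "x \<in> cball 0 1" for x
        using C[OF that] by (simp add: numeral_3_eq_3 numeral_2_eq_2)
    qed (use \<sigma> in auto)
    moreover have "(\<Sum>i\<le>2. poly (f i) 0 * E 0 * (\<sigma> - 0) ^ i / fact i) = 1 + poly (f 1) 0 * \<sigma> + poly (f 2) 0 / 2 * \<sigma>\<^sup>2"
      using assms by (simp add: f0 E_def numeral_2_eq_2)
    ultimately show "cmod (exp (- poly p \<sigma>) - (1 + poly (f 1) 0 * \<sigma> + poly (f 2) 0 / 2 * \<sigma>\<^sup>2)) \<le> C / 2 * cmod \<sigma> ^ 3"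
      by (simp add: f0 E_def eval_nat_numeral)
  qed
qed

text \<open>
  Replacing \<open>exp (- p)\<close> by a quadratic polynomial costs a cubic error, which a part of the gain
  \<open>\<epsilon> \<bar>\<sigma>\<bar>\<^sup>2\<close> absorbs near \<open>0\<close>. The aim is a disc of degree two, the only kind that the maximum
  principle above treats.
\<close>

lemma quadratic_minorant_of_exp_poly:
  fixes p :: "complex poly"
  assumes "poly p 0 = 0" "\<epsilon> > 0"
  obtains b d r where "r > 0"
    "\<And>\<sigma>. cmod \<sigma> < r \<Longrightarrow> cmod (1 + b * \<sigma> + d * \<sigma>\<^sup>2) + \<epsilon> / 4 * (cmod \<sigma>)\<^sup>2
        \<le> cmod (exp (- poly p \<sigma>)) * exp (\<epsilon> * (cmod \<sigma>)\<^sup>2)"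
proof -
  obtain b d C where Q:
    "\<And>\<sigma>. cmod \<sigma> \<le> 1 \<Longrightarrow> cmod (exp (- poly p \<sigma>) - (1 + b * \<sigma> + d * \<sigma>\<^sup>2)) \<le> C * cmod \<sigma> ^ 3"
    using exp_poly_quadratic_approx[OF assms(1)] by metis
  have nhds: "(f \<longlongrightarrow> f 0) (nhds 0)" if "continuous_on UNIV f" for f :: "complex \<Rightarrow> real"
    using that by (simp add: continuous_on_eq_continuous_at isCont_def tendsto_at_iff_tendsto_nhds)
  have "((\<lambda>\<sigma>. cmod (exp (- poly p \<sigma>))) \<longlongrightarrow> cmod (exp (- poly p 0))) (nhds 0)"
    "((\<lambda>\<sigma>::complex. C * cmod \<sigma>) \<longlongrightarrow> C * cmod 0) (nhds 0)"
    "((\<lambda>\<sigma>::complex. cmod \<sigma>) \<longlongrightarrow> cmod 0) (nhds 0)"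
    by (intro nhds continuous_intros)+
  from order_tendstoD(1)[OF this(1), of "1 / 2"] order_tendstoD(2)[OF this(2), of "\<epsilon> / 4"]
    order_tendstoD(2)[OF this(3), of 1]
  have "eventually (\<lambda>\<sigma>. 1 / 2 < cmod (exp (- poly p \<sigma>))) (nhds 0)"
    "eventually (\<lambda>\<sigma>. C * cmod \<sigma> < \<epsilon> / 4) (nhds 0)" "eventually (\<lambda>\<sigma>::complex. cmod \<sigma> < 1) (nhds 0)"
    using assms by auto
  then have "eventually (\<lambda>\<sigma>. 1 / 2 < cmod (exp (- poly p \<sigma>)) \<and> C * cmod \<sigma> < \<epsilon> / 4 \<and> cmod \<sigma> < 1) (nhds 0)"
    by eventually_elim auto
  then obtain r where r: "r > 0" "\<And>\<sigma>. cmod \<sigma> < r \<Longrightarrow> 1 / 2 < cmod (exp (- poly p \<sigma>))"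
    "\<And>\<sigma>. cmod \<sigma> < r \<Longrightarrow> C * cmod \<sigma> < \<epsilon> / 4" "\<And>\<sigma>. cmod \<sigma> < r \<Longrightarrow> cmod \<sigma> < 1"
    unfolding eventually_nhds_metric by auto
  show thesis
  proof (rule that[OF r(1)])
    fix \<sigma> assume \<sigma>: "cmod \<sigma> < r"
    define F where "F = exp (- poly p \<sigma>)"
    define q where "q = 1 + b * \<sigma> + d * \<sigma>\<^sup>2"
    have "cmod q \<le> cmod F + cmod (F - q)"
      using norm_triangle_ineq4[of F "F - q"] by simp
    also have "cmod (F - q) \<le> C * cmod \<sigma> ^ 3"
      unfolding F_def q_def using Q r(4)[OF \<sigma>] by simp
    also have "C * cmod \<sigma> ^ 3 = (C * cmod \<sigma>) * (cmod \<sigma>)\<^sup>2"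
      by (simp add: eval_nat_numeral)
    also have "\<dots> \<le> \<epsilon> / 4 * (cmod \<sigma>)\<^sup>2"
      using r(3)[OF \<sigma>] by (intro mult_right_mono) auto
    finally have "cmod q + \<epsilon> / 4 * (cmod \<sigma>)\<^sup>2 \<le> cmod F + \<epsilon> * (cmod \<sigma>)\<^sup>2 * (1 / 2)"
      by simp
    also have "\<epsilon> * (cmod \<sigma>)\<^sup>2 * (1 / 2) \<le> \<epsilon> * (cmod \<sigma>)\<^sup>2 * cmod F"
      using r(2)[OF \<sigma>] assms unfolding F_def by (intro mult_left_mono) auto
    also have "cmod F + \<epsilon> * (cmod \<sigma>)\<^sup>2 * cmod F = cmod F * (1 + \<epsilon> * (cmod \<sigma>)\<^sup>2)"
      by (simp add: algebra_simps)
    also have "\<dots> \<le> cmod F * exp (\<epsilon> * (cmod \<sigma>)\<^sup>2)"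
      by (intro mult_left_mono exp_ge_add_one_self) auto
    finally show "cmod (1 + b * \<sigma> + d * \<sigma>\<^sup>2) + \<epsilon> / 4 * (cmod \<sigma>)\<^sup>2
        \<le> cmod (exp (- poly p \<sigma>)) * exp (\<epsilon> * (cmod \<sigma>)\<^sup>2)"
      by (simp add: F_def q_def)
  qed
qed

lemma frontier_point_nearest:
  fixes D :: "'a::euclidean_space set"
  assumes "open D" "z \<in> D" "D \<noteq> UNIV"
  obtains a where "a \<in> frontier D" "dist z a = infdist z (- D)" "infdist z (- D) > 0"
proof -
  have ne: "closed (- D)" "- D \<noteq> {}" using assms by auto
  obtain a where a: "a \<in> - D" "infdist z (- D) = dist z a"
    using infdist_attains_inf[OF ne] by blast
  have "a \<noteq> z" using a assms by auto
  have "ball z (dist z a) \<subseteq> D"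
    using infdist_le[of _ "- D" z] a(2) by (force simp: not_le[symmetric])
  then have "closure (ball z (dist z a)) \<subseteq> closure D" by (rule closure_mono)
  then have "a \<in> closure D" using \<open>a \<noteq> z\<close> by auto
  then have "a \<in> frontier D" using a(1) assms(1) by (simp add: frontier_def interior_open)
  then show thesis using that a \<open>a \<noteq> z\<close> by auto
qed

text \<open>
  Apply \<open>touching_polynomial_if_not_submean\<close> to \<open>- ln \<delta>\<close>, where \<open>\<delta>\<close> is the distance to the complement, and exponentiate. A point at distance
  \<open>\<bar>q \<sigma>\<bar> * \<delta> z1\<close> from \<open>z1 + \<sigma> w\<close> still has distance at least \<open>\<delta> (z1 + \<sigma> w) - \<bar>q \<sigma>\<bar> * \<delta> z1\<close> from
  the complement. Moving from \<open>z1 + \<sigma> w\<close> by the complex multiple \<open>q \<sigma>\<close> of \<open>a - z1\<close>, with \<open>a\<close> a nearest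
  boundary point, makes the disc polynomial in \<open>\<sigma>\<close> and lets it pass through \<open>a\<close> at \<open>\<sigma> = 0\<close>.
\<close>

lemma touching_disc_if_not_submean:
  fixes D :: "(complex^'n) set"
  assumes "open D" "D \<noteq> UNIV" "r > 0" and sub: "\<And>\<tau>. \<tau> \<in> cball c r \<Longrightarrow> z + \<tau> *s w \<in> D"
    and fail: "\<not> ereal (- ln (infdist (z + c *s w) (- D)))
        \<le> circle_mean (\<lambda>\<tau>. ereal (- ln (infdist (z + \<tau> *s w) (- D)))) c r"
  obtains a A B \<kappa> r' where "a \<in> frontier D" "\<kappa> > 0" "r' > 0"
    "\<And>\<sigma>. cmod \<sigma> < r' \<Longrightarrow> \<kappa> * (cmod \<sigma>)\<^sup>2 \<le> infdist (a + \<sigma> *s A + \<sigma>\<^sup>2 *s B) (- D)"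
proof -
  define \<delta> where "\<delta> x = infdist x (- D)" for x
  have \<delta>_pos: "\<delta> x > 0" if "x \<in> D" for x
    using frontier_point_nearest[OF assms(1) that assms(2)] unfolding \<delta>_def by metis
  have "continuous_on (cball c r) (\<lambda>\<tau>. - ln (infdist (z + \<tau> *s w) (- D)))"
    using \<delta>_pos[OF sub]
    by (intro continuous_intros continuous_on_infdist ballI less_imp_neq[symmetric]) (simp_all add: \<delta>_def)
  note touching = touching_polynomial_if_not_submean[OF this \<open>r > 0\<close> fail, folded \<delta>_def]
  obtain \<tau>1 p \<epsilon> where \<tau>1: "\<tau>1 \<in> ball c r" and \<epsilon>: "\<epsilon> > 0" and p: "poly p 0 = 0"
    and le: "\<And>\<tau>. \<tau> \<in> cball c r \<Longrightarrow> - ln (\<delta> (z + \<tau> *s w))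
        \<le> - ln (\<delta> (z + \<tau>1 *s w)) + Re (poly p (\<tau> - \<tau>1)) - \<epsilon> * (cmod (\<tau> - \<tau>1))\<^sup>2"
    by (rule touching) (rule that)
  define z1 where "z1 = z + \<tau>1 *s w"
  have "z1 \<in> D" using sub \<tau>1 by (simp add: z1_def)
  obtain a where a: "a \<in> frontier D" "dist z1 a = \<delta> z1"
    using frontier_point_nearest[OF assms(1) \<open>z1 \<in> D\<close> assms(2)] unfolding \<delta>_def by metis
  obtain b d r1 where r1: "r1 > 0" and q:
    "\<And>\<sigma>. cmod \<sigma> < r1 \<Longrightarrow> cmod (1 + b * \<sigma> + d * \<sigma>\<^sup>2) + \<epsilon> / 4 * (cmod \<sigma>)\<^sup>2
        \<le> cmod (exp (- poly p \<sigma>)) * exp (\<epsilon> * (cmod \<sigma>)\<^sup>2)"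
    using quadratic_minorant_of_exp_poly[OF p \<epsilon>] by metis
  define r' where "r' = min r1 (r - dist c \<tau>1)"
  show thesis
  proof (rule that[OF a(1), of "\<delta> z1 * (\<epsilon> / 4)" r' "w + b *s (a - z1)" "d *s (a - z1)"])
    show "0 < \<delta> z1 * (\<epsilon> / 4)" using \<delta>_pos[OF \<open>z1 \<in> D\<close>] \<epsilon> by simp
    show "0 < r'" using r1 \<tau>1 by (simp add: r'_def)
    fix \<sigma> assume \<sigma>: "cmod \<sigma> < r'"
    define q where "q = 1 + b * \<sigma> + d * \<sigma>\<^sup>2"
    define y where "y = z1 + \<sigma> *s w"
    have "dist c (\<tau>1 + \<sigma>) \<le> dist c \<tau>1 + cmod \<sigma>"
      using dist_triangle[of c "\<tau>1 + \<sigma>" \<tau>1] by (simp add: dist_norm)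
    then have in_cball: "\<tau>1 + \<sigma> \<in> cball c r" using \<sigma> by (simp add: r'_def)
    have y_eq: "y = z + (\<tau>1 + \<sigma>) *s w" by (vector y_def z1_def) (simp add: algebra_simps)
    have "y \<in> D" using sub[OF in_cball] by (simp add: y_eq)
    have "- ln (\<delta> y) \<le> - ln (\<delta> z1) + Re (poly p \<sigma>) - \<epsilon> * (cmod \<sigma>)\<^sup>2"
      using le[OF in_cball] by (simp add: y_eq z1_def)
    then have "exp (ln (\<delta> z1) + Re (- poly p \<sigma>) + \<epsilon> * (cmod \<sigma>)\<^sup>2) \<le> exp (ln (\<delta> y))"
      by simp
    then have "\<delta> z1 * (cmod (exp (- poly p \<sigma>)) * exp (\<epsilon> * (cmod \<sigma>)\<^sup>2)) \<le> \<delta> y"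
      using \<delta>_pos[OF \<open>z1 \<in> D\<close>] \<delta>_pos[OF \<open>y \<in> D\<close>] by (simp add: exp_add exp_diff exp_minus norm_divide norm_exp_eq_Re field_simps)
    moreover have "\<delta> z1 * (cmod q + \<epsilon> / 4 * (cmod \<sigma>)\<^sup>2)
        \<le> \<delta> z1 * (cmod (exp (- poly p \<sigma>)) * exp (\<epsilon> * (cmod \<sigma>)\<^sup>2))"
      unfolding q_def using q[of \<sigma>] \<sigma> \<delta>_pos[OF \<open>z1 \<in> D\<close>] by (intro mult_left_mono) (auto simp: r'_def)
    ultimately have "\<delta> z1 * (\<epsilon> / 4) * (cmod \<sigma>)\<^sup>2 \<le> \<delta> y - cmod q * \<delta> z1"
      by (simp add: algebra_simps)
    also have "cmod q * \<delta> z1 = dist (y + q *s (a - z1)) y"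
      by (simp only: dist_norm add_diff_cancel_left' norm_vector_smult a(2)[symmetric] norm_minus_commute[of z1])
    also have "\<delta> y - dist (y + q *s (a - z1)) y \<le> \<delta> (y + q *s (a - z1))"
      using infdist_triangle[of y "- D" "y + q *s (a - z1)"] by (simp add: \<delta>_def dist_commute)
    also have "y + q *s (a - z1) = a + \<sigma> *s (w + b *s (a - z1)) + \<sigma>\<^sup>2 *s (d *s (a - z1))"
      by (vector y_def q_def) (simp add: algebra_simps)
    finally show "\<delta> z1 * (\<epsilon> / 4) * (cmod \<sigma>)\<^sup>2
        \<le> infdist (a + \<sigma> *s (w + b *s (a - z1)) + \<sigma>\<^sup>2 *s (d *s (a - z1))) (- D)"
      by (simp add: \<delta>_def)
  qed
qed

section \<open>Second-order behaviour of defining functions\<close>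

text \<open>
  The quadratic term is frozen at \<open>a\<close>, while the base point \<open>z\<close> may vary near \<open>a\<close>. Continuity of the
  second derivative alone gives an error that is a small multiple of \<open>(norm h)\<^sup>2\<close>, uniformly in \<open>z\<close>, and
  this uniformity is what allows comparing discs through different points.
\<close>

lemma uniform_second_order_Taylor:
  fixes f :: "'a::real_normed_vector \<Rightarrow> real" and f' :: "'a \<Rightarrow> 'a \<Rightarrow>\<^sub>L real"
    and f'' :: "'a \<Rightarrow> 'a \<Rightarrow>\<^sub>L ('a \<Rightarrow>\<^sub>L real)"
  assumes "open U" "a \<in> U"
    and f': "\<And>x. x \<in> U \<Longrightarrow> (f has_derivative blinfun_apply (f' x)) (at x)"
    and f'': "\<And>x. x \<in> U \<Longrightarrow> (f' has_derivative blinfun_apply (f'' x)) (at x)"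
    and cont: "continuous_on U f''" and "\<kappa> > 0"
  obtains e where "e > 0" "ball a e \<subseteq> U"
    "\<And>z h. z \<in> ball a e \<Longrightarrow> z + h \<in> ball a e \<Longrightarrow>
       \<bar>f (z + h) - f z - f' z h - f'' a h h / 2\<bar> \<le> \<kappa> * (norm h)\<^sup>2"
proof -
  obtain e1 where e1: "e1 > 0" "\<And>x. x \<in> U \<Longrightarrow> dist x a < e1 \<Longrightarrow> dist (f'' x) (f'' a) < \<kappa>"
    using cont \<open>a \<in> U\<close> \<open>\<kappa> > 0\<close> unfolding continuous_on_iff by metis
  obtain e2 where e2: "e2 > 0" "ball a e2 \<subseteq> U"
    using \<open>open U\<close> \<open>a \<in> U\<close> open_contains_ball by blast
  define e where "e = min e1 e2"
  have ballU: "x \<in> U" if "x \<in> ball a e" for x using that e2 by (auto simp: e_def)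
  have close: "norm (f'' x - f'' a) \<le> \<kappa>" if "x \<in> ball a e" for x
    using e1(2)[of x] ballU[OF that] that by (auto simp: e_def dist_norm norm_minus_commute)
  have first: "norm (f' y - f' x - f'' a (y - x)) \<le> \<kappa> * norm (y - x)"
    if "x \<in> ball a e" "y \<in> ball a e" for x y
  proof -
    have "norm ((f' y - f'' a y) - (f' x - f'' a x)) \<le> \<kappa> * norm (y - x)"
    proof (rule differentiable_bound[of "ball a e" "\<lambda>x. f' x - f'' a x" "\<lambda>x. blinfun_apply (f'' x - f'' a)"])
      fix x assume x: "x \<in> ball a e"
      have "((\<lambda>x. f' x - f'' a x) has_derivative (\<lambda>h. f'' x h - f'' a h)) (at x within ball a e)"
        by (intro has_derivative_diff has_derivative_at_withinI[OF f''[OF ballU[OF x]]]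
              bounded_linear_imp_has_derivative blinfun.bounded_linear_right)
      moreover have "(\<lambda>h. f'' x h - f'' a h) = blinfun_apply (f'' x - f'' a)"
        by (rule ext) (simp only: blinfun.diff_left)
      ultimately show "((\<lambda>x. f' x - f'' a x) has_derivative blinfun_apply (f'' x - f'' a)) (at x within ball a e)"
        by simp
      show "onorm (blinfun_apply (f'' x - f'' a)) \<le> \<kappa>"
        using close[OF x] by (simp add: norm_blinfun.rep_eq)
    qed (use that in auto)
    moreover have "(f' y - f'' a y) - (f' x - f'' a x) = f' y - f' x - f'' a (y - x)"
      by (simp only: blinfun.diff_right) simp
    ultimately show ?thesis by simp
  qed
  show thesis
  proof (rule that[of e])
    show "e > 0" using e1 e2 by (simp add: e_def)
    show "ball a e \<subseteq> U" using ballU by auto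
    fix z h assume zh: "z \<in> ball a e" "z + h \<in> ball a e"
    have seg: "z + t *\<^sub>R h \<in> ball a e" if "t \<in> {0..1}" for t
    proof -
      have "z + t *\<^sub>R h = (1 - t) *\<^sub>R z + t *\<^sub>R (z + h)" by (simp add: algebra_simps)
      then show ?thesis using convexD_alt[OF convex_ball zh, of t] that by simp
    qed
    define G where "G t = f (z + t *\<^sub>R h) - t * f' z h - t\<^sup>2 / 2 * f'' a h h" for t
    have "norm (G 1 - G 0) \<le> \<kappa> * (norm h)\<^sup>2 * norm (1 - 0 :: real)"
    proof (rule field_differentiable_bound[of "{0..1}" G
          "\<lambda>t. f' (z + t *\<^sub>R h) h - f' z h - t * f'' a h h"])
      fix t :: real assume t: "t \<in> {0..1}"
      have "((\<lambda>t. z + t *\<^sub>R h) has_derivative (\<lambda>t. t *\<^sub>R h)) (at t within {0..1})"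
        by (auto intro!: derivative_eq_intros)
      from has_derivative_compose[OF this f'[OF ballU[OF seg[OF t]]]]
      have "((\<lambda>t. f (z + t *\<^sub>R h)) has_real_derivative f' (z + t *\<^sub>R h) h) (at t within {0..1})"
        by (simp add: has_field_derivative_def blinfun.scaleR_right mult.commute[of _ "f' (z + t *\<^sub>R h) h"])
      then show "(G has_field_derivative f' (z + t *\<^sub>R h) h - f' z h - t * f'' a h h) (at t within {0..1})"
        unfolding G_def by (auto intro!: derivative_eq_intros)
      have "\<bar>(f' (z + t *\<^sub>R h) - f' z - f'' a (t *\<^sub>R h)) h\<bar> \<le> norm (f' (z + t *\<^sub>R h) - f' z - f'' a (t *\<^sub>R h)) * norm h"
        using norm_blinfun[of "f' (z + t *\<^sub>R h) - f' z - f'' a (t *\<^sub>R h)" h] by simp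
      also have "\<dots> \<le> (\<kappa> * norm (t *\<^sub>R h)) * norm h"
        using first[OF zh(1) seg[OF t]] by (intro mult_right_mono) auto
      also have "\<dots> \<le> \<kappa> * norm h * norm h"
        using t \<open>\<kappa> > 0\<close> by (intro mult_right_mono mult_left_mono) (auto simp: mult_left_le_one_le)
      finally show "norm (f' (z + t *\<^sub>R h) h - f' z h - t * f'' a h h) \<le> \<kappa> * (norm h)\<^sup>2"
        by (simp add: blinfun.diff_left blinfun.scaleR_left blinfun.scaleR_right power2_eq_square mult.assoc)
    qed auto
    then show "\<bar>f (z + h) - f z - f' z h - f'' a h h / 2\<bar> \<le> \<kappa> * (norm h)\<^sup>2"
      by (simp add: G_def)
  qed
qed

text \<open>
  The complex linear form whose real part is the given real linear form; for the derivative of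
  a function \<open>\<rho>\<close> it is twice the form \<open>\<partial>\<rho>\<close>. Its kernel is the complex tangent space.
\<close>

definition complex_form :: "((complex^'n) \<Rightarrow>\<^sub>L real) \<Rightarrow> complex^'n \<Rightarrow> complex" where
  "complex_form g v = Complex (g v) (- g (\<i> *s v))"

lemma smult_eq_scaleR: "\<tau> *s (v :: complex^'n) = Re \<tau> *\<^sub>R v + Im \<tau> *\<^sub>R (\<i> *s v)"
  by (vector complex_eq_iff)

lemma complex_form_smult: "complex_form g (\<tau> *s v) = \<tau> * complex_form g v"
proof -
  have "\<i> *s (\<tau> *s v) = Re \<tau> *\<^sub>R (\<i> *s v) - Im \<tau> *\<^sub>R v"
    by (vector complex_eq_iff)
  then have "g (\<i> *s (\<tau> *s v)) = Re \<tau> * g (\<i> *s v) - Im \<tau> * g v"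
    by (simp add: blinfun.diff_right blinfun.scaleR_right)
  moreover have "g (\<tau> *s v) = Re \<tau> * g v + Im \<tau> * g (\<i> *s v)"
    by (subst smult_eq_scaleR) (simp add: blinfun.add_right blinfun.scaleR_right)
  ultimately show ?thesis by (simp add: complex_form_def complex_eq_iff)
qed

lemma complex_form_diff: "complex_form g (v - w) = complex_form g v - complex_form g w"
proof -
  have "\<i> *s (v - w) = \<i> *s v - \<i> *s w" by (vector algebra_simps)
  then show ?thesis by (simp add: complex_form_def complex_eq_iff blinfun.diff_right)
qed

lemma Re_complex_form: "Re (complex_form g v) = g v"
  by (simp add: complex_form_def)

lemma isCont_complex_form:
  assumes "isCont f' a"
  shows "isCont (\<lambda>z. complex_form (f' z) v) a"
  unfolding complex_form_def complex_eq_iff continuous_complex_iff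
  using assms by (auto intro!: continuous_intros)

text \<open>
  Along every real line \<open>t \<mapsto> t \<sigma>\<close> in the parameter the function has a local maximum at \<open>0\<close>, so the
  real derivative vanishes on all complex multiples of \<open>A\<close>.
\<close>

lemma tangential_if_local_max:
  fixes \<rho> :: "complex^'n \<Rightarrow> real"
  assumes d: "(\<rho> has_derivative blinfun_apply g) (at a)" and "s > 0"
    and max: "\<And>\<sigma>. cmod \<sigma> < s \<Longrightarrow> \<rho> (a + \<sigma> *s A + \<sigma>\<^sup>2 *s B) \<le> \<rho> a"
  shows "complex_form g A = 0"
proof -
  have g0: "g (\<sigma> *s A) = 0" if \<sigma>: "cmod \<sigma> = 1" for \<sigma>
  proof -
    define \<gamma> where "\<gamma> t = a + t *\<^sub>R (\<sigma> *s A) + t\<^sup>2 *\<^sub>R (\<sigma>\<^sup>2 *s B)" for t :: real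
    have "(\<gamma> has_derivative (\<lambda>t. t *\<^sub>R (\<sigma> *s A))) (at 0)"
      unfolding \<gamma>_def by (auto intro!: derivative_eq_intros)
    moreover have "\<gamma> 0 = a" by (simp add: \<gamma>_def)
    ultimately have "((\<lambda>t. \<rho> (\<gamma> t)) has_derivative (\<lambda>t. g (t *\<^sub>R (\<sigma> *s A)))) (at 0)"
      using has_derivative_compose[of \<gamma> _ 0 UNIV \<rho> "blinfun_apply g"] d by simp
    then have "((\<lambda>t. \<rho> (\<gamma> t)) has_real_derivative g (\<sigma> *s A)) (at 0)"
      by (simp add: has_field_derivative_def blinfun.scaleR_right mult.commute[of _ "g (\<sigma> *s A)"])
    then show ?thesis
    proof (rule DERIV_local_max[OF _ \<open>s > 0\<close>], intro allI impI)
      fix t :: real assume "\<bar>0 - t\<bar> < s"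
      then have "cmod (of_real t * \<sigma>) < s" by (simp add: norm_mult \<sigma>)
      moreover have "\<gamma> t = a + (of_real t * \<sigma>) *s A + (of_real t * \<sigma>)\<^sup>2 *s B"
        by (vector \<gamma>_def) (simp add: scaleR_conv_of_real power_mult_distrib mult.assoc)
      ultimately show "\<rho> (\<gamma> t) \<le> \<rho> (\<gamma> 0)"
        using max[of "of_real t * \<sigma>"] by (simp add: \<open>\<gamma> 0 = a\<close>)
    qed
  qed
  have "1 *s A = A" by vector
  then show ?thesis using g0[of 1] g0[of \<i>] by (simp add: complex_form_def complex_eq_iff)
qed

text \<open>
  From a point \<open>x\<close> of \<open>D\<close> one can move less than \<open>infdist x (- D)\<close> in the direction \<open>n\<close> in
  which \<open>\<rho>\<close> increases with speed at least \<open>m\<close>, and \<open>\<rho>\<close> is still negative there.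
\<close>

lemma defining_function_le_neg_infdist:
  fixes D :: "'a::real_normed_vector set"
  assumes "open U" "a \<in> U" "a \<notin> D"
    and f': "\<And>x. x \<in> U \<Longrightarrow> (\<rho> has_derivative blinfun_apply (f' x)) (at x)"
    and cont: "isCont f' a" and "f' a \<noteq> 0"
    and neg: "D \<inter> U = {z \<in> U. \<rho> z < 0}"
  obtains m e where "m > 0" "e > 0" "ball a e \<subseteq> U"
    "\<And>x. x \<in> D \<inter> ball a e \<Longrightarrow> \<rho> x \<le> - m * infdist x (- D)"
proof -
  obtain n0 where n0: "f' a n0 \<noteq> 0"
    using \<open>f' a \<noteq> 0\<close> by (metis blinfun_eqI zero_blinfun.rep_eq)
  then have "n0 \<noteq> 0" by (auto simp: blinfun.zero_right)
  define n where "n = (sgn (f' a n0) / norm n0) *\<^sub>R n0"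
  have "norm n = 1" using n0 \<open>n0 \<noteq> 0\<close> by (simp add: n_def sgn_if)
  have fan: "f' a n > 0" using n0 \<open>n0 \<noteq> 0\<close>
    by (auto simp: n_def blinfun.scaleR_right sgn_if divide_simps zero_less_mult_iff)
  define m where "m = f' a n / 2"
  have "m > 0" "m < f' a n" using fan by (auto simp: m_def)
  have "((\<lambda>x. f' x n) \<longlongrightarrow> f' a n) (at a)"
    using cont by (intro blinfun.tendsto tendsto_const) (simp add: isCont_def)
  then have "eventually (\<lambda>x. m < f' x n) (at a)"
    using \<open>m < f' a n\<close> by (rule order_tendstoD)
  then obtain e1 where e1: "e1 > 0" "\<And>x. x \<noteq> a \<Longrightarrow> dist x a < e1 \<Longrightarrow> m < f' x n"
    unfolding eventually_at by auto
  obtain e2 where e2: "e2 > 0" "ball a e2 \<subseteq> U"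
    using \<open>open U\<close> \<open>a \<in> U\<close> open_contains_ball by blast
  define e where "e = min e1 e2 / 2"
  have big: "x \<in> U \<and> m < f' x n" if "dist x a < 2 * e" for x
    using that e1(2)[of x] e2(2) \<open>m < f' a n\<close> by (cases "x = a") (auto simp: e_def dist_commute subset_iff)
  show thesis
  proof (rule that[of m e])
    show "e > 0" using e1 e2 by (simp add: e_def)
    show "ball a e \<subseteq> U" using big \<open>e > 0\<close> by (auto simp: dist_commute)
    fix x assume x: "x \<in> D \<inter> ball a e"
    define d where "d = infdist x (- D)"
    have "d \<le> dist x a" unfolding d_def using \<open>a \<notin> D\<close> by (intro infdist_le) auto
    then have "d < e" using x by (simp add: dist_commute)
    have "d \<ge> 0" by (simp add: d_def infdist_nonneg)
    have "\<rho> x \<le> - m * t" if t: "0 \<le> t" "t < d" for t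
    proof -
      have pt: "dist (x + s *\<^sub>R n) a < 2 * e" if "0 \<le> s" "s \<le> t" for s
      proof -
        have "dist (x + s *\<^sub>R n) a \<le> s + dist x a"
          using norm_triangle_ineq[of "s *\<^sub>R n" "x - a"] that \<open>norm n = 1\<close>
          by (simp add: dist_norm algebra_simps)
        then show ?thesis using x \<open>d < e\<close> t that by (simp add: dist_commute)
      qed
      have "x + t *\<^sub>R n \<in> D"
      proof (rule ccontr)
        assume "x + t *\<^sub>R n \<notin> D"
        then have "d \<le> dist x (x + t *\<^sub>R n)" unfolding d_def by (intro infdist_le) auto
        then show False using t \<open>norm n = 1\<close> by (simp add: dist_norm)
      qed
      then have "\<rho> (x + t *\<^sub>R n) < 0" using pt[of t] t big neg by blast
      have mono: "(\<lambda>s. \<rho> (x + s *\<^sub>R n) - m * s) 0 \<le> (\<lambda>s. \<rho> (x + s *\<^sub>R n) - m * s) t"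
      proof (rule DERIV_nonneg_imp_nondecreasing[OF t(1)])
        fix s assume s: "0 \<le> s" "s \<le> t"
        have "((\<lambda>s. x + s *\<^sub>R n) has_derivative (\<lambda>s. s *\<^sub>R n)) (at s)"
          by (auto intro!: derivative_eq_intros)
        from has_derivative_compose[OF this f'[of "x + s *\<^sub>R n"]] big[OF pt[OF s]]
        have "((\<lambda>s. \<rho> (x + s *\<^sub>R n)) has_real_derivative f' (x + s *\<^sub>R n) n) (at s)"
          by (simp add: has_field_derivative_def blinfun.scaleR_right mult.commute[of _ "f' (x + s *\<^sub>R n) n"])
        then have "((\<lambda>s. \<rho> (x + s *\<^sub>R n) - m * s) has_real_derivative f' (x + s *\<^sub>R n) n - m) (at s)"
          by (auto intro!: derivative_eq_intros)
        then show "\<exists>y. ((\<lambda>s. \<rho> (x + s *\<^sub>R n) - m * s) has_real_derivative y) (at s) \<and> 0 \<le> y"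
          using big[OF pt[OF s]] by (intro exI[of _ "f' (x + s *\<^sub>R n) n - m"]) auto
      qed
      then show ?thesis using \<open>\<rho> (x + t *\<^sub>R n) < 0\<close> by simp
    qed
    note * = this
    have "\<rho> x \<le> - m * d"
    proof (cases "d = 0")
      case True
      have "x \<in> {z \<in> U. \<rho> z < 0}" using neg x \<open>ball a e \<subseteq> U\<close> by blast
      with True show ?thesis by simp
    next
      case False
      then have "d > 0" using \<open>d \<ge> 0\<close> by simp
      have "d \<le> - \<rho> x / m"
      proof (rule dense_le_bounded[OF \<open>d > 0\<close>])
        fix t assume "0 < t" "t < d"
        then show "t \<le> - \<rho> x / m" using *[of t] \<open>m > 0\<close> by (simp add: field_simps)
      qed
      then show ?thesis using \<open>m > 0\<close> by (simp add: field_simps)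
    qed
    then show "\<rho> x \<le> - m * infdist x (- D)" by (simp add: d_def)
  qed (use \<open>m > 0\<close> in simp)
qed

text \<open>
  By the second-order Taylor formula, the hypothesis on the disc through \<open>a\<close> is an inequality for
  first and second derivatives at \<open>a\<close>, which changes little if the centre moves to a point \<open>z\<close> near \<open>a\<close>. Only
  the term of \<open>\<rho>\<close> that is linear in \<open>\<sigma>\<close> could spoil it, being of lower order. It vanishes at \<open>a\<close>,
  and at \<open>z\<close> it is made to vanish by replacing \<open>A\<close> by the nearby vector \<open>A' z\<close>, the projection
  of \<open>A\<close> to the complex tangent space of the level set of \<open>\<rho>\<close> through \<open>z\<close>, along a fixed transversal vector \<open>n\<close>.
\<close>

lemma touching_disc_propagates:
  fixes \<rho> :: "complex^'n \<Rightarrow> real"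
  assumes "open U" "a \<in> U" "C2_with_derivative_on \<rho> \<rho>' U" "\<rho>' a \<noteq> 0"
    and "c > 0" "s0 > 0"
    and touch: "\<And>\<sigma>. cmod \<sigma> < s0 \<Longrightarrow> \<rho> (a + \<sigma> *s A + \<sigma>\<^sup>2 *s B) \<le> \<rho> a - c * (cmod \<sigma>)\<^sup>2"
    and "R > 0"
  obtains s e A' where "s > 0" "e > 0"
    "\<And>z \<sigma>. z \<in> ball a e \<Longrightarrow> cmod \<sigma> \<le> s \<Longrightarrow> z + \<sigma> *s A' z + \<sigma>\<^sup>2 *s B \<in> ball a R"
    "\<And>z \<sigma>. z \<in> ball a e \<Longrightarrow> cmod \<sigma> \<le> s \<Longrightarrow>
        \<rho> (z + \<sigma> *s A' z + \<sigma>\<^sup>2 *s B) \<le> \<rho> z - c / 2 * (cmod \<sigma>)\<^sup>2"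
proof -
  obtain f'' where d: "\<And>x. x \<in> U \<Longrightarrow> (\<rho> has_derivative blinfun_apply (\<rho>' x)) (at x)"
    and d2: "\<And>x. x \<in> U \<Longrightarrow> (\<rho>' has_derivative blinfun_apply (f'' x)) (at x)"
    and cont: "continuous_on U f''"
    using assms(3) unfolding C2_with_derivative_on_def by blast
  have cont': "isCont \<rho>' a" using d2[OF \<open>a \<in> U\<close>] by (rule has_derivative_continuous)
  have tang: "complex_form (\<rho>' a) A = 0"
  proof (rule tangential_if_local_max[OF d[OF \<open>a \<in> U\<close>] \<open>s0 > 0\<close>])
    fix \<sigma> assume "cmod \<sigma> < s0"
    from touch[OF this] show "\<rho> (a + \<sigma> *s A + \<sigma>\<^sup>2 *s B) \<le> \<rho> a"
      using \<open>c > 0\<close> by (smt (verit) mult_nonneg_nonneg zero_le_power2)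
  qed
  obtain n where n: "\<rho>' a n \<noteq> 0"
    using \<open>\<rho>' a \<noteq> 0\<close> by (metis blinfun_eqI zero_blinfun.rep_eq)
  then have form_n: "complex_form (\<rho>' a) n \<noteq> 0" by (metis Re_complex_form zero_complex.sel(1))
  define \<mu> where "\<mu> z = complex_form (\<rho>' z) A / complex_form (\<rho>' z) n" for z
  define A' where "A' z = A - \<mu> z *s n" for z
  have cont_\<mu>: "isCont \<mu> a"
    unfolding \<mu>_def using isCont_complex_form[OF cont'] form_n by (intro continuous_intros) auto
  have \<mu>a: "\<mu> a = 0" by (simp add: \<mu>_def tang)

  \<comment> \<open>\<open>L \<bar>\<sigma>\<bar>\<close> bounds all displacements below. The loss \<open>c / 2\<close> is split into four parts \<open>c / 8\<close>: two
    Taylor remainders, and the changes of the first and of the second derivative.\<close>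
  define L where "L = norm A + norm B + 1"
  have "L \<ge> 1" by (simp add: L_def)
  define \<kappa> where "\<kappa> = c / (8 * L\<^sup>2)"
  have "\<kappa> > 0" using \<open>c > 0\<close> \<open>L \<ge> 1\<close> by (simp add: \<kappa>_def)
  have \<kappa>L: "\<kappa> * L\<^sup>2 = c / 8" using \<open>L \<ge> 1\<close> by (simp add: \<kappa>_def)
  define Q where "Q = f'' a"
  obtain e0 where e0: "e0 > 0" "ball a e0 \<subseteq> U"
    and Taylor: "\<And>z h. z \<in> ball a e0 \<Longrightarrow> z + h \<in> ball a e0 \<Longrightarrow>
       \<bar>\<rho> (z + h) - \<rho> z - \<rho>' z h - Q h h / 2\<bar> \<le> \<kappa> * (norm h)\<^sup>2"
    using uniform_second_order_Taylor[OF \<open>open U\<close> \<open>a \<in> U\<close> d d2 cont \<open>\<kappa> > 0\<close>] unfolding Q_def by metis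
  define R' where "R' = min e0 R"
  have "R' > 0" using e0 \<open>R > 0\<close> by (simp add: R'_def)
  define s where "s = Min {1, s0 / 2, R' / (4 * L)}"
  have s: "s > 0" "s \<le> 1" "s \<le> s0 / 2" "s \<le> R' / (4 * L)"
    using \<open>s0 > 0\<close> \<open>R' > 0\<close> \<open>L \<ge> 1\<close> by (auto simp: s_def)
  have sL: "s * L \<le> R' / 4" using s(4) \<open>L \<ge> 1\<close> by (simp add: field_simps)

  have lim1: "((\<lambda>z. norm (\<rho>' z - \<rho>' a) * norm B) \<longlongrightarrow> 0) (at a)"
    using cont' by (intro tendsto_eq_intros | simp add: isCont_def)+
  have lim2: "((\<lambda>z. norm (A' z - A)) \<longlongrightarrow> 0) (at a)"
    using cont_\<mu> \<mu>a by (auto simp: A'_def isCont_def norm_vector_smult intro!: tendsto_eq_intros)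
  have lim3: "((\<lambda>z. norm Q * L * norm (A' z - A)) \<longlongrightarrow> 0) (at a)"
    by (rule tendsto_eq_intros lim2 | simp)+
  have lim4: "((\<lambda>z. complex_form (\<rho>' z) n) \<longlongrightarrow> complex_form (\<rho>' a) n) (at a)"
    using isCont_complex_form[OF cont'] by (simp add: isCont_def)
  have "eventually (\<lambda>z. norm (\<rho>' z - \<rho>' a) * norm B < c / 8) (at a)"
    "eventually (\<lambda>z. norm (A' z - A) < 1) (at a)"
    "eventually (\<lambda>z. norm Q * L * norm (A' z - A) < c / 8) (at a)"
    "eventually (\<lambda>z. complex_form (\<rho>' z) n \<noteq> 0) (at a)"
    using \<open>c > 0\<close> order_tendstoD(2)[OF lim1, of "c / 8"] order_tendstoD(2)[OF lim2, of 1]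
      order_tendstoD(2)[OF lim3, of "c / 8"] tendsto_imp_eventually_ne[OF lim4 form_n]
    by (simp_all only: divide_pos_pos zero_less_one zero_less_numeral)
  then have "eventually (\<lambda>z. norm (\<rho>' z - \<rho>' a) * norm B < c / 8 \<and> norm (A' z - A) < 1 \<and>
      norm Q * L * norm (A' z - A) < c / 8 \<and> complex_form (\<rho>' z) n \<noteq> 0) (at a)"
    by eventually_elim simp
  then obtain e1 where e1: "e1 > 0" and close':
    "\<And>z. z \<noteq> a \<Longrightarrow> dist z a < e1 \<Longrightarrow> norm (\<rho>' z - \<rho>' a) * norm B < c / 8 \<and> norm (A' z - A) < 1 \<and>
      norm Q * L * norm (A' z - A) < c / 8 \<and> complex_form (\<rho>' z) n \<noteq> 0"
    unfolding eventually_at by auto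
  have "A' a = A" by (simp add: A'_def \<mu>a)
  then have close: "norm (\<rho>' z - \<rho>' a) * norm B < c / 8" "norm (A' z - A) < 1"
      "norm Q * L * norm (A' z - A) < c / 8" "complex_form (\<rho>' z) n \<noteq> 0" if "dist z a < e1" for z
    using close'[OF _ that] form_n \<open>c > 0\<close> by (cases "z = a"; simp)+
  define e where "e = min e1 (R' / 2)"
  have *: "z + \<sigma> *s A' z + \<sigma>\<^sup>2 *s B \<in> ball a R \<and>
           \<rho> (z + \<sigma> *s A' z + \<sigma>\<^sup>2 *s B) \<le> \<rho> z - c / 2 * (cmod \<sigma>)\<^sup>2"
    if z: "z \<in> ball a e" and \<sigma>: "cmod \<sigma> \<le> s" for z \<sigma>
  proof -
    define t where "t = cmod \<sigma>"
    have t: "0 \<le> t" "t \<le> s" "t \<le> 1" using \<sigma> s by (auto simp: t_def)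
    have z1: "dist z a < e1" using z by (simp add: e_def dist_commute)
    have size: "norm (\<sigma> *s v + \<sigma>\<^sup>2 *s B) \<le> t * L" if "norm v \<le> norm A + 1" for v
    proof -
      have "norm (\<sigma> *s v + \<sigma>\<^sup>2 *s B) \<le> t * norm v + t\<^sup>2 * norm B"
        using norm_triangle_ineq[of "\<sigma> *s v" "\<sigma>\<^sup>2 *s B"] by (simp add: norm_vector_smult norm_power t_def)
      also have "\<dots> \<le> t * (norm A + 1) + t * norm B"
        using t that by (intro add_mono mult_left_mono mult_right_mono) (auto simp: power2_eq_square mult_left_le)
      finally show ?thesis by (simp add: L_def algebra_simps)
    qed
    define h where "h = \<sigma> *s A' z + \<sigma>\<^sup>2 *s B"
    define k where "k = \<sigma> *s A + \<sigma>\<^sup>2 *s B"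
    have "norm (A' z) \<le> norm A + 1"
      using close(2)[OF z1] norm_triangle_ineq2[of "A' z" A] by simp
    then have nh: "norm h \<le> t * L" unfolding h_def by (rule size)
    have nk: "norm k \<le> t * L" unfolding k_def by (rule size) simp
    have hk: "h - k = \<sigma> *s (A' z - A)" by (vector h_def k_def) (simp add: algebra_simps)
    have "t * L \<le> s * L" using t \<open>L \<ge> 1\<close> by (intro mult_right_mono) auto
    then have tL: "t * L \<le> R' / 4" using sL by simp
    have za: "dist a z < R' / 2" using z by (simp add: e_def)
    have "dist a (z + h) \<le> dist a z + norm h"
      using dist_triangle[of a "z + h" z] by (simp add: dist_norm)
    then have zh: "dist a (z + h) < R'" using nh tL za \<open>R' > 0\<close> by simp
    have ak: "dist a (a + k) < R'" using nk tL \<open>R' > 0\<close> by (simp add: dist_norm)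
    have "complex_form (\<rho>' z) (A' z) = 0"
    proof -
      have "complex_form (\<rho>' z) (A' z) = complex_form (\<rho>' z) A - \<mu> z * complex_form (\<rho>' z) n"
        unfolding A'_def by (simp only: complex_form_diff complex_form_smult)
      then show ?thesis using close(4)[OF z1] by (simp add: \<mu>_def)
    qed
    then have "complex_form (\<rho>' z) (\<sigma> *s A' z) = 0" by (simp add: complex_form_smult)
    then have "\<rho>' z (\<sigma> *s A' z) = 0" by (metis Re_complex_form zero_complex.sel(1))
    then have lin_z: "\<rho>' z h = \<rho>' z (\<sigma>\<^sup>2 *s B)" by (simp add: h_def blinfun.add_right)
    have "complex_form (\<rho>' a) (\<sigma> *s A) = 0" by (simp add: complex_form_smult tang)
    then have "\<rho>' a (\<sigma> *s A) = 0" by (metis Re_complex_form zero_complex.sel(1))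
    then have lin_a: "\<rho>' a k = \<rho>' a (\<sigma>\<^sup>2 *s B)" by (simp add: k_def blinfun.add_right)
    have "\<rho>' z h - \<rho>' a k = (\<rho>' z - \<rho>' a) (\<sigma>\<^sup>2 *s B)" by (simp add: lin_z lin_a blinfun.diff_left)
    also have "\<dots> \<le> norm (\<rho>' z - \<rho>' a) * norm (\<sigma>\<^sup>2 *s B)"
      using norm_blinfun[of "\<rho>' z - \<rho>' a" "\<sigma>\<^sup>2 *s B"] by simp
    also have "\<dots> = norm (\<rho>' z - \<rho>' a) * norm B * t\<^sup>2"
      by (simp add: norm_vector_smult norm_power t_def)
    also have "\<dots> \<le> c / 8 * t\<^sup>2" using close(1)[OF z1] by (intro mult_right_mono) auto
    finally have lin: "\<rho>' z h - \<rho>' a k \<le> c / 8 * t\<^sup>2" .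
    have "Q h h - Q k k = Q (h - k) h + Q k (h - k)"
      by (simp add: blinfun.diff_right blinfun.diff_left)
    also have "\<dots> \<le> norm Q * norm (h - k) * norm h + norm Q * norm k * norm (h - k)"
    proof (rule add_mono)
      have *: "Q v w \<le> norm Q * norm v * norm w" for v w
        using norm_blinfun[of "Q v" w] mult_right_mono[OF norm_blinfun[of Q v], of "norm w"] by simp
      show "Q (h - k) h \<le> norm Q * norm (h - k) * norm h" "Q k (h - k) \<le> norm Q * norm k * norm (h - k)"
        by (rule *)+
    qed
    also have "\<dots> = norm Q * norm (h - k) * (norm h + norm k)" by (simp add: algebra_simps)
    also have "\<dots> \<le> norm Q * norm (h - k) * (2 * (t * L))"
      using nh nk by (intro mult_left_mono) auto
    also have "\<dots> = 2 * (norm Q * L * norm (A' z - A)) * t\<^sup>2"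
      by (simp only: hk norm_vector_smult t_def power2_eq_square) simp
    also have "\<dots> \<le> 2 * (c / 8) * t\<^sup>2"
      using close(3)[OF z1] by (intro mult_right_mono) auto
    finally have quad: "Q h h / 2 - Q k k / 2 \<le> c / 8 * t\<^sup>2" by simp
    have sq: "\<kappa> * (norm v)\<^sup>2 \<le> c / 8 * t\<^sup>2" if "norm v \<le> t * L" for v :: "complex^'n"
    proof -
      have "\<kappa> * (norm v)\<^sup>2 \<le> \<kappa> * (t * L)\<^sup>2"
        using that \<open>\<kappa> > 0\<close> by (intro mult_left_mono power_mono) auto
      also have "\<dots> = c / 8 * t\<^sup>2" by (simp add: power_mult_distrib \<kappa>L[symmetric])
      finally show ?thesis .
    qed
    have "\<bar>\<rho> (z + h) - \<rho> z - \<rho>' z h - Q h h / 2\<bar> \<le> c / 8 * t\<^sup>2"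
      using Taylor[of z h] za zh sq[OF nh] \<open>R' > 0\<close> by (simp add: R'_def)
    moreover have "\<bar>\<rho> (a + k) - \<rho> a - \<rho>' a k - Q k k / 2\<bar> \<le> c / 8 * t\<^sup>2"
      using Taylor[of a k] ak sq[OF nk] e0 by (simp add: R'_def)
    moreover have "\<rho> (a + k) \<le> \<rho> a - c * t\<^sup>2"
      using touch[of \<sigma>] \<sigma> s(1,3) by (simp add: k_def t_def add.assoc)
    ultimately have "\<rho> (z + h) \<le> \<rho> z - c / 2 * t\<^sup>2"
      using lin quad by linarith
    then show ?thesis using zh by (simp add: h_def t_def R'_def add.assoc)
  qed
  show thesis
    by (rule that[of s e A']) (use s e1 \<open>R' > 0\<close> * in \<open>auto simp: e_def\<close>)
qed

section \<open>The distance to the boundary\<close>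

text \<open>
  The discs through points \<open>z\<close> near \<open>a\<close> have a common radius \<open>s\<close>, and \<open>\<rho> \<le> \<rho> z - b < - b\<close> on their
  boundaries for a constant \<open>b > 0\<close>. So the boundaries lie in the compact set \<open>K\<close>, where \<open>u\<close> is bounded above, and the
  maximum principle carries the bound to the centres. The bound \<open>- b / 2\<close> in \<open>K\<close> leaves room for
  the open set \<open>W\<close> that the maximum principle asks for.
\<close>

lemma plurisubharmonic_bounded_near_touching_point:
  fixes D :: "(complex^'n) set"
  assumes "C2_boundary D" "open D" "a \<in> frontier D"
    and "\<kappa> > 0" "r > 0"
    and touch: "\<And>\<sigma>. cmod \<sigma> < r \<Longrightarrow> \<kappa> * (cmod \<sigma>)\<^sup>2 \<le> infdist (a + \<sigma> *s A + \<sigma>\<^sup>2 *s B) (- D)"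
    and "open V" "a \<in> V" and u: "plurisubharmonic_on u (D \<inter> V)"
  obtains M :: real where "eventually (\<lambda>z. u z \<le> ereal M) (at a within D \<inter> V)"
proof -
  from bspec[OF \<open>C2_boundary D\<close>[unfolded C2_boundary_def] \<open>a \<in> frontier D\<close>]
  obtain U \<rho> \<rho>' where U: "open U" "a \<in> U" and C2: "C2_with_derivative_on \<rho> \<rho>' U"
    and nz': "\<forall>z\<in>U. \<rho>' z \<noteq> 0" and neg: "D \<inter> U = {z \<in> U. \<rho> z < 0}"
    by (elim exE conjE)
  have nz: "\<rho>' a \<noteq> 0" using nz' \<open>a \<in> U\<close> by blast
  obtain f'' where d: "\<And>x. x \<in> U \<Longrightarrow> (\<rho> has_derivative blinfun_apply (\<rho>' x)) (at x)"
    and d2: "\<And>x. x \<in> U \<Longrightarrow> (\<rho>' has_derivative blinfun_apply (f'' x)) (at x)"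
    using C2 unfolding C2_with_derivative_on_def by blast
  have cont: "isCont \<rho> x" if "x \<in> U" for x using d[OF that] by (rule has_derivative_continuous)
  have cont': "isCont \<rho>' a" using d2[OF \<open>a \<in> U\<close>] by (rule has_derivative_continuous)
  have "a \<notin> D" "a \<in> closure D"
    using \<open>open D\<close> \<open>a \<in> frontier D\<close> by (auto simp: frontier_def interior_open)
  have "\<rho> a \<ge> 0" using neg \<open>a \<notin> D\<close> \<open>a \<in> U\<close> by force
  obtain m e1 where m: "m > 0" and e1: "e1 > 0" "ball a e1 \<subseteq> U"
    and le: "\<And>x. x \<in> D \<inter> ball a e1 \<Longrightarrow> \<rho> x \<le> - m * infdist x (- D)"
    using defining_function_le_neg_infdist[OF U \<open>a \<notin> D\<close> d cont' nz neg] by metis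
  define \<phi> where "\<phi> \<sigma> = a + \<sigma> *s A + \<sigma>\<^sup>2 *s B" for \<sigma>
  have "continuous_on UNIV \<phi>" unfolding \<phi>_def by (intro continuous_intros)
  moreover have "\<phi> 0 = a" by (simp add: \<phi>_def)
  ultimately obtain s1 where s1: "s1 > 0" "\<And>\<sigma>. cmod \<sigma> < s1 \<Longrightarrow> \<phi> \<sigma> \<in> ball a e1"
    using e1(1) unfolding continuous_on_iff
    by (metis UNIV_I dist_0_norm dist_commute mem_ball)
  define s0 where "s0 = min s1 r"
  have "s0 > 0" using s1 \<open>r > 0\<close> by (simp add: s0_def)
  have off: "\<rho> (\<phi> \<sigma>) \<le> - (m * \<kappa>) * (cmod \<sigma>)\<^sup>2" if "cmod \<sigma> < s0" "\<sigma> \<noteq> 0" for \<sigma>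
  proof -
    have dist: "\<kappa> * (cmod \<sigma>)\<^sup>2 \<le> infdist (\<phi> \<sigma>) (- D)"
      using touch[of \<sigma>] that by (simp add: \<phi>_def s0_def)
    have "0 < \<kappa> * (cmod \<sigma>)\<^sup>2" using \<open>\<kappa> > 0\<close> that by simp
    with dist have "infdist (\<phi> \<sigma>) (- D) \<noteq> 0" by linarith
    then have "\<phi> \<sigma> \<in> D" using infdist_zero[of "\<phi> \<sigma>" "- D"] by blast
    then have "\<rho> (\<phi> \<sigma>) \<le> - m * infdist (\<phi> \<sigma>) (- D)" using le s1(2) that by (simp add: s0_def)
    also have "\<dots> \<le> - m * (\<kappa> * (cmod \<sigma>)\<^sup>2)" using dist m by (intro mult_left_mono_neg) auto
    finally show ?thesis by simp
  qed
  have "\<rho> a \<le> 0"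
  proof (rule ccontr)
    assume "\<not> \<rho> a \<le> 0"
    then have "eventually (\<lambda>x. 0 < \<rho> x) (nhds a)"
      using cont[OF \<open>a \<in> U\<close>] by (auto simp: isCont_def tendsto_at_iff_tendsto_nhds intro: order_tendstoD)
    then obtain T where T: "open T" "a \<in> T" "\<And>x. x \<in> T \<Longrightarrow> 0 < \<rho> x"
      unfolding eventually_nhds by blast
    then have "D \<inter> (T \<inter> U) \<noteq> {}"
      using \<open>a \<in> closure D\<close> U open_Int_closure_eq_empty[of "T \<inter> U" D] by blast
    then obtain x where "x \<in> D \<inter> U" "x \<in> T" by blast
    then show False using T(3)[of x] unfolding neg by auto
  qed
  then have "\<rho> a = 0" using \<open>\<rho> a \<ge> 0\<close> by simp
  have touch': "\<rho> (a + \<sigma> *s A + \<sigma>\<^sup>2 *s B) \<le> \<rho> a - m * \<kappa> * (cmod \<sigma>)\<^sup>2" if "cmod \<sigma> < s0" for \<sigma>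
    using off[OF that] \<open>\<rho> a = 0\<close> by (cases "\<sigma> = 0") (auto simp: \<phi>_def)
  have "open (U \<inter> V)" "a \<in> U \<inter> V" using U \<open>open V\<close> \<open>a \<in> V\<close> by auto
  then obtain R where R: "R > 0" "cball a R \<subseteq> U \<inter> V"
    by (meson open_contains_cball)
  have "m * \<kappa> > 0" using m \<open>\<kappa> > 0\<close> by simp
  obtain s e A' where s: "s > 0" and e: "e > 0"
    and inball: "\<And>z \<sigma>. z \<in> ball a e \<Longrightarrow> cmod \<sigma> \<le> s \<Longrightarrow> z + \<sigma> *s A' z + \<sigma>\<^sup>2 *s B \<in> ball a R"
    and below: "\<And>z \<sigma>. z \<in> ball a e \<Longrightarrow> cmod \<sigma> \<le> s \<Longrightarrow>
        \<rho> (z + \<sigma> *s A' z + \<sigma>\<^sup>2 *s B) \<le> \<rho> z - m * \<kappa> / 2 * (cmod \<sigma>)\<^sup>2"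
    using touching_disc_propagates[OF U C2 nz \<open>m * \<kappa> > 0\<close> \<open>s0 > 0\<close> touch' R(1)] by metis
  define b where "b = m * \<kappa> / 2 * s\<^sup>2"
  have "b > 0" using \<open>m * \<kappa> > 0\<close> s by (simp add: b_def)
  have cont_R: "continuous_on (cball a R) \<rho>"
    using R cont by (intro continuous_at_imp_continuous_on) auto
  define K where "K = {x \<in> cball a R. \<rho> x \<le> - b / 2}"
  have "K = cball a R \<inter> \<rho> -` {..- b / 2}" by (auto simp: K_def)
  then have "closed K"
    using continuous_closed_preimage[OF cont_R closed_cball closed_atMost] by simp
  moreover have "bounded K"
    by (rule bounded_subset[OF bounded_cball[of a R]]) (auto simp: K_def)
  ultimately have "compact K" by (simp add: compact_eq_bounded_closed)
  have "K \<subseteq> D \<inter> V"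
  proof
    fix x assume x: "x \<in> K"
    then have "x \<in> U \<inter> V" using R(2) by (auto simp: K_def)
    moreover have "\<rho> x < 0" using x \<open>b > 0\<close> by (simp add: K_def)
    ultimately show "x \<in> D \<inter> V" using neg by blast
  qed
  obtain M where M: "\<And>x. x \<in> K \<Longrightarrow> u x \<le> ereal M"
    using usc_bounded_above_on_compact[OF _ \<open>compact K\<close> \<open>K \<subseteq> D \<inter> V\<close>] u
    unfolding plurisubharmonic_on_def by metis
  define W where "W = {x \<in> ball a R. \<rho> x < - b / 2}"
  have "open W"
    unfolding W_def
    using continuous_open_preimage[OF continuous_on_subset[OF cont_R ball_subset_cball] open_ball open_lessThan[of "- b / 2"]]
    by (simp add: vimage_def Int_def)
  have bound: "u z \<le> ereal M" if z: "z \<in> D \<inter> V" "z \<in> ball a (min e R)" for z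
  proof (rule plurisubharmonic_max_principle_quadratic_disc[OF u _ s])
    have "z \<in> U" using z(2) R by auto
    then have "\<rho> z < 0" using z(1) neg by blast
    show "open (D \<inter> V)" using \<open>open D\<close> \<open>open V\<close> by (rule open_Int)
    fix \<sigma> assume \<sigma>: "cmod \<sigma> \<le> s"
    define x where "x = z + \<sigma> *s A' z + \<sigma>\<^sup>2 *s B"
    have "x \<in> ball a R" using inball[of z \<sigma>] z(2) \<sigma> by (simp add: x_def)
    have "\<rho> x \<le> \<rho> z - m * \<kappa> / 2 * (cmod \<sigma>)\<^sup>2" using below[of z \<sigma>] z(2) \<sigma> by (simp add: x_def)
    also have "\<dots> < 0" using \<open>\<rho> z < 0\<close> \<open>m * \<kappa> > 0\<close> by (smt (verit) divide_pos_pos mult_nonneg_nonneg zero_le_power2)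
    finally have "x \<in> {z \<in> U. \<rho> z < 0} \<inter> V" using \<open>x \<in> ball a R\<close> R by auto
    then show "z + \<sigma> *s A' z + \<sigma>\<^sup>2 *s B \<in> D \<inter> V" using neg by (auto simp: x_def)
  next
    have "z \<in> U" using z(2) R by auto
    then have "\<rho> z < 0" using z(1) neg by blast
    fix \<sigma> assume \<sigma>: "cmod \<sigma> = s"
    have "\<rho> (z + \<sigma> *s A' z + \<sigma>\<^sup>2 *s B) \<le> \<rho> z - b"
      using below[of z \<sigma>] z(2) \<sigma> by (simp add: b_def)
    then show "z + \<sigma> *s A' z + \<sigma>\<^sup>2 *s B \<in> W"
      using inball[of z \<sigma>] z(2) \<sigma> \<open>\<rho> z < 0\<close> \<open>b > 0\<close> by (simp add: W_def)
  next
    fix x assume "x \<in> D \<inter> V \<inter> W"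
    then show "u x \<le> ereal M" using M[of x] by (auto simp: W_def K_def)
  qed (rule \<open>open W\<close>)
  show thesis
  proof (rule that[of M])
    show "eventually (\<lambda>z. u z \<le> ereal M) (at a within D \<inter> V)"
      unfolding eventually_at
      by (rule exI[of _ "min e R"]) (use bound e R in \<open>auto simp: dist_commute\<close>)
  qed
qed

lemma norm_square_submean:
  fixes z w :: "complex^'n"
  shows "ereal ((norm (z + c *s w))\<^sup>2) \<le> circle_mean (\<lambda>\<tau>. ereal ((norm (z + \<tau> *s w))\<^sup>2)) c r"
proof -
  define p where "p = z + c *s w"
  define k where "k = (\<Sum>i\<in>UNIV. cnj (p $ i) * w $ i)"
  define P where "P = [: of_real ((norm p)\<^sup>2 + r\<^sup>2 * (norm w)\<^sup>2), 2 * k :]"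
  have "ereal ((norm p)\<^sup>2) \<le> ereal (Re (poly P 0))" by (simp add: P_def)
  also have "\<dots> = circle_mean (\<lambda>\<tau>. ereal (Re (poly P (\<tau> - c)))) c r"
    by (rule circle_mean_Re_poly[symmetric])
  also have "\<dots> \<le> circle_mean (\<lambda>\<tau>. ereal ((norm (z + \<tau> *s w))\<^sup>2)) c r"
  proof (rule circle_mean_mono)
    fix \<tau> assume "dist c \<tau> = \<bar>r\<bar>"
    then have r: "(cmod (\<tau> - c))\<^sup>2 = r\<^sup>2" by (simp add: dist_norm norm_minus_commute)
    have "z + \<tau> *s w = p + (\<tau> - c) *s w" by (vector p_def) (simp add: algebra_simps)
    moreover have "(norm (p + h))\<^sup>2 = (norm p)\<^sup>2 + 2 * inner p h + (norm h)\<^sup>2" for h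
      by (simp add: power2_norm_eq_inner algebra_simps inner_commute)
    ultimately have "(norm (z + \<tau> *s w))\<^sup>2
        = (norm p)\<^sup>2 + 2 * inner p ((\<tau> - c) *s w) + (norm ((\<tau> - c) *s w))\<^sup>2"
      by (simp only:)
    also have "\<dots> = Re (poly P (\<tau> - c))"
      by (simp only: inner_smult_eq_Re k_def[symmetric] norm_vector_smult power_mult_distrib r)
         (simp add: P_def algebra_simps)
    finally show "ereal (Re (poly P (\<tau> - c))) \<le> ereal ((norm (z + \<tau> *s w))\<^sup>2)" by simp
  qed
  finally show ?thesis by (simp add: p_def)
qed

lemma usc_on_continuous:
  fixes f :: "'a::topological_space \<Rightarrow> real"
  assumes "continuous_on S f"
  shows "usc_on (\<lambda>x. ereal (f x)) S"
proof -
  have "continuous_on S (\<lambda>x. ereal (f x))" using assms by (intro continuous_intros)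
  then have "openin (top_of_set S) (S \<inter> (\<lambda>x. ereal (f x)) -` {..<c})" for c
    by (rule continuous_openin_preimage_gen) simp
  then show ?thesis by (simp add: usc_on_def vimage_def Int_def)
qed

text \<open>
  Taking the maximum with \<open>(norm z)\<^sup>2\<close> makes the sublevel sets bounded. With \<open>v = 0\<close> this covers the
  whole space, with \<open>v = - ln \<delta>\<close> all other domains.
\<close>

lemma pseudoconvex_if_closed_sublevels:
  fixes D :: "(complex^'n) set" and v :: "complex^'n \<Rightarrow> real"
  assumes "open D" and v: "continuous_on D v"
    and submean: "\<And>z w c r. 0 < r \<Longrightarrow> (\<And>\<tau>. \<tau> \<in> cball c r \<Longrightarrow> z + \<tau> *s w \<in> D) \<Longrightarrow>
        ereal (v (z + c *s w)) \<le> circle_mean (\<lambda>\<tau>. ereal (v (z + \<tau> *s w))) c r"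
    and closed: "\<And>c. closed {z \<in> D. v z \<le> c}"
  shows "pseudoconvex D"
proof -
  define u where "u z = max (v z) ((norm z)\<^sup>2)" for z
  have cont: "continuous_on D u"
    unfolding u_def by (intro continuous_intros v)
  have psh: "plurisubharmonic_on (\<lambda>z. ereal (u z)) D"
    unfolding plurisubharmonic_on_def subharmonic_on_def
  proof (intro conjI allI impI)
    show "usc_on (\<lambda>z. ereal (u z)) D" using cont by (rule usc_on_continuous)
    fix z w
    show "usc_on (\<lambda>\<tau>. ereal (u (z + \<tau> *s w))) {\<tau>. z + \<tau> *s w \<in> D}"
      by (intro usc_on_continuous continuous_on_compose2[OF cont] continuous_intros) auto
    fix c r assume *: "0 < r \<and> cball c r \<subseteq> {\<tau>. z + \<tau> *s w \<in> D}"
    have "ereal (v (z + c *s w)) \<le> circle_mean (\<lambda>\<tau>. ereal (v (z + \<tau> *s w))) c r"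
      using * by (intro submean) auto
    also have "\<dots> \<le> circle_mean (\<lambda>\<tau>. ereal (u (z + \<tau> *s w))) c r"
      by (rule circle_mean_mono) (simp add: u_def)
    finally have 1: "ereal (v (z + c *s w)) \<le> circle_mean (\<lambda>\<tau>. ereal (u (z + \<tau> *s w))) c r" .
    have "circle_mean (\<lambda>\<tau>. ereal ((norm (z + \<tau> *s w))\<^sup>2)) c r \<le> circle_mean (\<lambda>\<tau>. ereal (u (z + \<tau> *s w))) c r"
      by (rule circle_mean_mono) (simp add: u_def)
    with norm_square_submean[of z c w r]
    have 2: "ereal ((norm (z + c *s w))\<^sup>2) \<le> circle_mean (\<lambda>\<tau>. ereal (u (z + \<tau> *s w))) c r"
      by (rule order_trans)
    show "ereal (u (z + c *s w)) \<le> circle_mean (\<lambda>\<tau>. ereal (u (z + \<tau> *s w))) c r"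
      using 1 2 by (simp add: u_def max_def)
  qed
  have "compact (closure {z \<in> D. u z < c}) \<and> closure {z \<in> D. u z < c} \<subseteq> D" for c
  proof -
    have "{z \<in> D. u z < c} \<subseteq> {z \<in> D. v z \<le> c}" by (auto simp: u_def)
    then have "closure {z \<in> D. u z < c} \<subseteq> {z \<in> D. v z \<le> c}"
      using closed by (rule closure_minimal)
    moreover have "norm z \<le> c + 1" if "z \<in> {z \<in> D. u z < c}" for z
    proof -
      have "(norm z)\<^sup>2 < c" using that by (auto simp: u_def)
      moreover have "0 \<le> (norm z - 1)\<^sup>2" by simp
      ultimately show ?thesis by (simp add: power2_eq_square algebra_simps) (smt (verit) norm_ge_zero)
    qed
    then have "bounded {z \<in> D. u z < c}" unfolding bounded_iff by blast
    ultimately show ?thesis by (auto simp: compact_closure)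
  qed
  with cont psh \<open>open D\<close> show ?thesis unfolding pseudoconvex_def by blast
qed

theorem proposition2:
  fixes D :: "(complex^'n) set"
  assumes "open D" and "connected D"
    and "C2_boundary D"
    and "\<And>a. a \<in> frontier D \<Longrightarrow>
           \<exists>U u. open U \<and> a \<in> U \<and> plurisubharmonic_on u (D \<inter> U) \<and>
                 Limsup (at a within D \<inter> U) u = \<infinity>"
  shows "pseudoconvex D"
proof (cases "D = UNIV")
  case True
  show ?thesis
  proof (rule pseudoconvex_if_closed_sublevels[OF \<open>open D\<close>, of "\<lambda>_. 0"])
    show "ereal 0 \<le> circle_mean (\<lambda>\<tau>. ereal 0) c r" for c r
      using circle_mean_Re_poly[of 0 c r] by simp
    show "closed {z \<in> D. 0 \<le> c}" for c :: real
      using True by (cases "0 \<le> c") auto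
  qed auto
next
  case False
  define \<delta> where "\<delta> z = infdist z (- D)" for z
  have pos: "\<delta> z > 0" if "z \<in> D" for z
    using frontier_point_nearest[OF \<open>open D\<close> that False] unfolding \<delta>_def by metis
  have cont: "continuous_on S \<delta>" for S
    unfolding \<delta>_def by (intro continuous_intros)
  show ?thesis
  proof (rule pseudoconvex_if_closed_sublevels[OF \<open>open D\<close>, of "\<lambda>z. - ln (\<delta> z)"])
    show "continuous_on D (\<lambda>z. - ln (\<delta> z))"
      using pos by (intro continuous_intros cont) force
  next
    fix c
    have "{z \<in> D. - ln (\<delta> z) \<le> c} = {z. exp (- c) \<le> \<delta> z}"
    proof (intro set_eqI iffI)
      fix z assume "z \<in> {z \<in> D. - ln (\<delta> z) \<le> c}"
      then have "z \<in> D" "- c \<le> ln (\<delta> z)" by auto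
      then show "z \<in> {z. exp (- c) \<le> \<delta> z}" using pos[of z] by (simp add: ln_ge_iff)
    next
      fix z assume z: "z \<in> {z. exp (- c) \<le> \<delta> z}"
      then have "\<delta> z > 0" using exp_gt_zero[of "- c"] by (simp del: exp_gt_zero)
      moreover from this have "z \<in> D" by (cases "z \<in> D") (auto simp: \<delta>_def)
      moreover have "- c \<le> ln (\<delta> z)" using z \<open>\<delta> z > 0\<close> by (simp add: ln_ge_iff)
      ultimately show "z \<in> {z \<in> D. - ln (\<delta> z) \<le> c}" by simp
    qed
    moreover have "closed {z. exp (- c) \<le> \<delta> z}"
      using cont[of UNIV] by (intro closed_Collect_le continuous_intros)
    ultimately show "closed {z \<in> D. - ln (\<delta> z) \<le> c}" by simp
  next
    fix z w c and r :: real assume "0 < r" and sub: "\<And>\<tau>. \<tau> \<in> cball c r \<Longrightarrow> z + \<tau> *s w \<in> D"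
    show "ereal (- ln (\<delta> (z + c *s w))) \<le> circle_mean (\<lambda>\<tau>. ereal (- ln (\<delta> (z + \<tau> *s w)))) c r"
    proof (rule ccontr)
      assume fail: "\<not> ?thesis"
      obtain a A B \<kappa> r' where a: "a \<in> frontier D" and "\<kappa> > 0" "r' > 0"
        and touch: "\<And>\<sigma>. cmod \<sigma> < r' \<Longrightarrow> \<kappa> * (cmod \<sigma>)\<^sup>2 \<le> infdist (a + \<sigma> *s A + \<sigma>\<^sup>2 *s B) (- D)"
        using touching_disc_if_not_submean[OF \<open>open D\<close> False \<open>0 < r\<close> sub fail[unfolded \<delta>_def]] by metis
      obtain V u where V: "open V" "a \<in> V" and u: "plurisubharmonic_on u (D \<inter> V)"
        and lim: "Limsup (at a within D \<inter> V) u = \<infinity>"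
        using assms(4)[OF a] by blast
      obtain M where "eventually (\<lambda>z. u z \<le> ereal M) (at a within D \<inter> V)"
        using plurisubharmonic_bounded_near_touching_point[OF \<open>C2_boundary D\<close> \<open>open D\<close> a \<open>\<kappa> > 0\<close> \<open>r' > 0\<close> touch V u]
        by metis
      then have "Limsup (at a within D \<inter> V) u \<le> ereal M" by (rule Limsup_bounded)
      with lim show False by simp
    qed
  qed
qed

end
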